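(* Let $X$ be a smooth finite-dimensional manifold and let $H_{2i+1}\in\Omega^{2i+1}(X)$, $i\geq 1$, be differential forms. There is a twisted graded de Rham complex with differential $$d+\sum_{i=1}^{\infty} v_{(i)}^{-1}\,H_{2i+1}\wedge\;,$$ i.e. this operator squares to zero, provided the differential forms $H_{2i+1}$ are closed. The coefficients $v_{(i)}$ are constant as differential forms ($dv_{(i)}=0$) and can be taken to be either dependent or independent.
   Context: The $v_{(i)}$ are invertible elements of even degree in a graded commutative coefficient ring $R$ (an algebra over $\mathbb{R}$), graded so that each $v_{(i)}^{-1}H_{2i+1}$ has total degree one; they commute with all differential forms. The operator acts on $\Omega^\bullet(X)\otimes R$. "Dependent or independent" means that algebraic relations among the $v_{(i)}$ (for example $v_{(i)}=u^i$ for a single invertible element $u$) are permitted but not required. The sum is finite on a finite-dimensional manifold. *)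

theory Defs
  imports "HOL-Analysis.Analysis" "HOL-Library.Function_Algebras"
begin

section \<open>Smooth manifolds\<close>

text \<open>
  C^k for a map on an open set of a finite-dimensional space. There, continuity of all iterated
  directional derivatives is the same as continuity of the iterated total derivatives.
\<close>

primrec Ck_on :: "nat \<Rightarrow> 'e::real_normed_vector set \<Rightarrow> ('e \<Rightarrow> 'b::real_normed_vector) \<Rightarrow> bool" where
  "Ck_on 0 S f \<longleftrightarrow> continuous_on S f"
| "Ck_on (Suc k) S f \<longleftrightarrow>
     (\<forall>x\<in>S. f differentiable (at x)) \<and> (\<forall>u. Ck_on k S (\<lambda>x. frechet_derivative f (at x) u))"

definition smooth_on :: "'e::real_normed_vector set \<Rightarrow> ('e \<Rightarrow> 'b::real_normed_vector) \<Rightarrow> bool" where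
  "smooth_on S f \<longleftrightarrow> (\<forall>k. Ck_on k S f)"

text \<open>A chart is its domain together with the coordinate map; values off the domain are irrelevant.\<close>

type_synonym ('a, 'e) chart = "'a set \<times> ('a \<Rightarrow> 'e)"

definition chart_image :: "('a, 'e) chart \<Rightarrow> 'e set" where
  "chart_image c = snd c ` fst c"

definition transition :: "('a, 'e) chart \<Rightarrow> ('a, 'e) chart \<Rightarrow> 'e \<Rightarrow> 'e" where
  "transition c c' = snd c' \<circ> inv_into (fst c) (snd c)"

text \<open>
  The model space is a finite-dimensional real inner product space. The class
  \<open>euclidean_space\<close> is avoided because it excludes dimension 0.
\<close>

definition smooth_manifold :: "'a topology \<Rightarrow> ('a, 'e::real_inner) chart set \<Rightarrow> bool" where
  "smooth_manifold X A \<longleftrightarrow>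
     (\<exists>B::'e set. finite B \<and> span B = UNIV) \<and>
     Hausdorff_space X \<and> second_countable X \<and>
     (\<forall>c\<in>A. openin X (fst c) \<and> open (chart_image c) \<and>
        homeomorphic_map (subtopology X (fst c)) (top_of_set (chart_image c)) (snd c)) \<and>
     topspace X = (\<Union>c\<in>A. fst c) \<and>
     (\<forall>c\<in>A. \<forall>c'\<in>A. smooth_on (snd c ` (fst c \<inter> fst c')) (transition c c'))"


section \<open>Differential forms\<close>

text \<open>
  A differential form on X is a family of forms on the chart images that agree under pullback
  along the transition maps. The value \<open>\<omega> c x vs\<close> is the local representative in the chart \<open>c\<close>,
  at the point \<open>x\<close> of the chart image, on the tangent vectors \<open>vs\<close>. The length of \<open>vs\<close> is the
  degree, so one function can carry components of several degrees; a form of degree k vanishes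
  on lists of any other length. The last parameter is the type of values: real for ordinary
  forms, the coefficient ring for forms with coefficients.
\<close>

type_synonym ('a, 'e, 'r) form = "('a, 'e) chart \<Rightarrow> 'e \<Rightarrow> 'e list \<Rightarrow> 'r"

definition alternating_multilinear :: "nat \<Rightarrow> ('e::real_vector list \<Rightarrow> real) \<Rightarrow> bool" where
  "alternating_multilinear k f \<longleftrightarrow>
     (\<forall>vs i. length vs = k \<and> i < k \<longrightarrow> linear (\<lambda>v. f (vs[i := v]))) \<and>
     (\<forall>vs i j. length vs = k \<and> i < j \<and> j < k \<and> vs ! i = vs ! j \<longrightarrow> f vs = 0)"

definition forms :: "('a, 'e::real_inner) chart set \<Rightarrow> nat \<Rightarrow> ('a, 'e, real) form set" where
  "forms A k = {\<omega>.
     (\<forall>c x vs. \<not> (c \<in> A \<and> x \<in> chart_image c \<and> length vs = k) \<longrightarrow> \<omega> c x vs = 0) \<and>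
     (\<forall>c\<in>A. \<forall>x\<in>chart_image c. alternating_multilinear k (\<omega> c x)) \<and>
     (\<forall>c\<in>A. \<forall>vs. length vs = k \<longrightarrow> smooth_on (chart_image c) (\<lambda>x. \<omega> c x vs)) \<and>
     (\<forall>c\<in>A. \<forall>c'\<in>A. \<forall>p \<in> fst c \<inter> fst c'. \<forall>vs. length vs = k \<longrightarrow>
        \<omega> c (snd c p) vs =
        \<omega> c' (snd c' p) (map (frechet_derivative (transition c c') (at (snd c p))) vs))}"

text \<open>
  In a chart, d\<omega>(v0,...,vk) is the sum over i of (-1)^i times the derivative, in the direction vi,
  of \<omega>(v0,...,vk) with vi omitted, the vectors being held constant.
\<close>

definition ext_d :: "('a, 'e::real_inner, real) form \<Rightarrow> ('a, 'e, real) form" where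
  "ext_d \<omega> = (\<lambda>c x vs. if x \<in> chart_image c
     then \<Sum>i<length vs. (-1) ^ i *
            frechet_derivative (\<lambda>y. \<omega> c y (take i vs @ drop (Suc i) vs)) (at x) (vs ! i)
     else 0)"

text \<open>
  The wedge product as a sum over shuffles. A shuffle is given by the set I of positions that go
  to the first factor; its sign is (-1) to the number of inversions.
\<close>

definition shuffle_sign :: "nat set \<Rightarrow> real" where
  "shuffle_sign I = (-1) ^ card {(i, j). i \<in> I \<and> j \<notin> I \<and> j < i}"

definition wedge :: "('a, 'e, real) form \<Rightarrow> ('a, 'e, real) form \<Rightarrow> ('a, 'e, real) form" where
  "wedge \<alpha> \<beta> = (\<lambda>c x vs. \<Sum>I\<in>Pow {..<length vs}.
     shuffle_sign I * \<alpha> c x (nths vs I) * \<beta> c x (nths vs (- I)))"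


section \<open>Graded commutative coefficients\<close>

definition graded_commutative :: "(int \<Rightarrow> 'r::real_algebra_1 set) \<Rightarrow> bool" where
  "graded_commutative G \<longleftrightarrow>
     (\<forall>k. subspace (G k)) \<and>
     (\<forall>r. \<exists>!f. (\<forall>k. f k \<in> G k) \<and> finite {k. f k \<noteq> 0} \<and> r = (\<Sum>k | f k \<noteq> 0. f k)) \<and>
     1 \<in> G 0 \<and>
     (\<forall>j k. \<forall>a\<in>G j. \<forall>b\<in>G k. a * b \<in> G (j + k)) \<and>
     (\<forall>j k. \<forall>a\<in>G j. \<forall>b\<in>G k. a * b = (if odd j \<and> odd k then - (b * a) else b * a))"

text \<open>
  The tensor product over the reals of the space of forms with R is realised inside the R-valued
  functions: \<open>\<omega> \<otimes> r\<close> is the R-valued form with value \<open>\<omega> c x vs *\<^sub>R r\<close>. Since forms are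
  real-valued functions, the canonical map from the algebraic tensor product to R-valued functions
  is injective, so its image, the set of finite sums of such elements, is the tensor product.
\<close>

definition tensor :: "('a, 'e, real) form \<Rightarrow> 'r::real_algebra_1 \<Rightarrow> ('a, 'e, 'r) form" where
  "tensor \<omega> r = (\<lambda>c x vs. \<omega> c x vs *\<^sub>R r)"

definition tensor_sum ::
  "(('a, 'e, real) form \<times> 'r::real_algebra_1) list \<Rightarrow> ('a, 'e, 'r) form" where
  "tensor_sum ts = (\<Sum>(\<omega>, r)\<leftarrow>ts. tensor \<omega> r)"

definition forms_tensor ::
  "('a, 'e::real_inner) chart set \<Rightarrow> ('a, 'e, 'r::real_algebra_1) form set" where
  "forms_tensor A = {tensor_sum ts |ts. \<forall>(\<omega>, r)\<in>set ts. \<exists>p. \<omega> \<in> forms A p}"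

text \<open>Total degree is form degree plus coefficient degree.\<close>

definition forms_tensor_deg ::
  "('a, 'e::real_inner) chart set \<Rightarrow> (int \<Rightarrow> 'r::real_algebra_1 set) \<Rightarrow> int \<Rightarrow> ('a, 'e, 'r) form set" where
  "forms_tensor_deg A G m =
     {tensor_sum ts |ts. \<forall>(\<omega>, r)\<in>set ts. \<exists>p q. \<omega> \<in> forms A p \<and> r \<in> G q \<and> int p + q = m}"

text \<open>
  The map S \<open>\<otimes>\<close> T for linear S and T, sending \<open>\<omega> \<otimes> r\<close> to \<open>S \<omega> \<otimes> T r\<close>. The description
  operator is justified because the result does not depend on the representation as a sum.
\<close>

definition tensor_map ::
  "('a, 'e::real_inner) chart set \<Rightarrow> (('a, 'e, real) form \<Rightarrow> ('a, 'e, real) form) \<Rightarrow> ('r \<Rightarrow> 'r) \<Rightarrow>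
   ('a, 'e, 'r::real_algebra_1) form \<Rightarrow> ('a, 'e, 'r) form" where
  "tensor_map A S T \<eta> = (THE \<zeta>. \<exists>ts. (\<forall>(\<omega>, r)\<in>set ts. \<exists>p. \<omega> \<in> forms A p) \<and>
     \<eta> = tensor_sum ts \<and> \<zeta> = tensor_sum (map (\<lambda>(\<omega>, r). (S \<omega>, T r)) ts))"


section \<open>The twisted differential\<close>

text \<open>
  The argument \<open>w i\<close> is the inverse of the coefficient of degree 2i. As it is even, no Koszul
  sign arises when it moves past a form. Acting by \<open>d \<otimes> id\<close> expresses that coefficients are
  constant. The sum over all \<open>i \<ge> 1\<close> is written over the indices of the nonzero forms.
\<close>

definition twisted_d ::
  "('a, 'e::real_inner) chart set \<Rightarrow> (nat \<Rightarrow> ('a, 'e, real) form) \<Rightarrow> (nat \<Rightarrow> 'r::real_algebra_1) \<Rightarrow>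
   ('a, 'e, 'r) form \<Rightarrow> ('a, 'e, 'r) form" where
  "twisted_d A H w \<eta> =
     tensor_map A ext_d id \<eta> + (\<Sum>i | 1 \<le> i \<and> H i \<noteq> 0. tensor_map A (wedge (H i)) ((*) (w i)) \<eta>)"

definition cochain_complex ::
  "(int \<Rightarrow> ('a, 'e, 'r::real_algebra_1) form set) \<Rightarrow> (('a, 'e, 'r) form \<Rightarrow> ('a, 'e, 'r) form) \<Rightarrow> bool" where
  "cochain_complex C D \<longleftrightarrow> (\<forall>m.
     (\<forall>\<eta>\<in>C m. D \<eta> \<in> C (m + 1) \<and> D (D \<eta>) = 0) \<and>
     (\<forall>\<eta>\<in>C m. \<forall>\<xi>\<in>C m. D (\<eta> + \<xi>) = D \<eta> + D \<xi>) \<and>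
     (\<forall>a. \<forall>\<eta>\<in>C m. D (\<lambda>c x vs. a *\<^sub>R \<eta> c x vs) = (\<lambda>c x vs. a *\<^sub>R D \<eta> c x vs)))"

end

theory Submission
  imports Defs
begin

text \<open>
  A form in a chart is a function on lists of vectors. Splitting off the first vector gives
  \<open>\<iota>\<^sub>v (\<alpha> \<and> \<beta>) = \<iota>\<^sub>v \<alpha> \<and> \<beta> \<plusminus> \<alpha> \<and> \<iota>\<^sub>v \<beta>\<close> and, for a constant vector v, Cartan's formula
  \<open>\<iota>\<^sub>v d + d \<iota>\<^sub>v = \<partial>\<^sub>v\<close>. From these recursions, induction on the list yields associativity and
  graded commutativity of the wedge product, the Leibniz rule, and \<open>d\<^sup>2 = 0\<close>, the last because
  directional derivatives commute. In the square of the twisted differential, the terms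
  \<open>d (H\<^sub>i \<and> \<omega>)\<close> and \<open>H\<^sub>i \<and> d\<omega>\<close> cancel since the odd form \<open>H\<^sub>i\<close> is closed, and the terms
  \<open>H\<^sub>j \<and> H\<^sub>i \<and> \<omega>\<close> cancel in pairs since odd forms anticommute and the coefficients, inverses of
  homogeneous elements of even degree, commute.
\<close>

section \<open>Smooth functions and the symmetry of second derivatives\<close>


text \<open>Two obstacles lie outside the algebra. The derivative must respect changes of chart:
  under a transition the base point and the vectors vary together, while smoothness of a form is
  given only for fixed vectors. Expanding the vectors in an orthogonal spanning set turns their
  variation into scalar coefficients, and the second derivatives of the transition that appear are
  symmetric, hence cancel in the alternating sum. Moreover, operators on forms with coefficients are
  given by a description over all representations as finite sums, so independence of the
  representation has to be shown; linear functionals on the coefficient ring separate points and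
  reduce this to real-valued forms. Two facts are derived rather than assumed: the inverse of a
  homogeneous element is homogeneous of opposite degree, and forms of degree above the size of a
  finite spanning set vanish, which makes the sum finite. Associativity, the Leibniz rule and d d =
  0 are proved for arbitrary functions on lists, mixed degrees included; \<open>involute\<close>
  carries the sign.\<close>

lemma differentiable_imp_frechet:
  "f differentiable (at x) \<Longrightarrow> (f has_derivative frechet_derivative f (at x)) (at x)"
  by (simp add: frechet_derivative_works)

lemma frechet_derivative_eqI: "(f has_derivative f') (at x) \<Longrightarrow> frechet_derivative f (at x) = f'"
  by (metis frechet_derivative_at)

text \<open>On an open set a derivative depends only on the values there. The sum and product rules
  are available only at points of \<open>S\<close>, so the inductions below pass through this lemma
  to replace a derivative by its formula.\<close>

lemma Ck_on_cong:
  assumes "open S" "\<And>x. x \<in> S \<Longrightarrow> f x = g x" "Ck_on k S f"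
  shows "Ck_on k S g"
  using assms(2,3)
proof (induction k arbitrary: f g)
  case 0
  then show ?case by (metis Ck_on.simps(1) continuous_on_cong)
next
  case (Suc k)
  have d: "(g has_derivative frechet_derivative f (at x)) (at x)" if "x \<in> S" for x
    using that Suc.prems assms(1) has_derivative_transform_within_open differentiable_imp_frechet
    by (metis Ck_on.simps(2))
  have "Ck_on k S (\<lambda>x. frechet_derivative g (at x) u)" for u
    by (rule Suc.IH[of "\<lambda>x. frechet_derivative f (at x) u"])
      (use Suc.prems frechet_derivative_eqI[OF d] in simp_all)
  then show ?case using d by (auto simp: differentiable_def)
qed

lemma Ck_on_continuous: "Ck_on k S f \<Longrightarrow> continuous_on S f"
  by (cases k) (simp_all add: differentiable_imp_continuous_on differentiable_at_imp_differentiable_on)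

lemma Ck_on_SucD: "Ck_on (Suc k) S f \<Longrightarrow> Ck_on k S f"
proof (induction k arbitrary: f)
  case 0
  then show ?case using Ck_on_continuous[OF 0] by simp
next
  case (Suc k)
  from Suc.prems have "\<forall>x\<in>S. f differentiable (at x)" "Ck_on (Suc k) S (\<lambda>x. frechet_derivative f (at x) u)" for u
    by (simp_all del: Ck_on.simps add: Ck_on.simps(2)[of "Suc k"])
  with Suc.IH show ?case unfolding Ck_on.simps(2)[of k] by blast
qed

lemma Ck_on_add:
  assumes "open S" shows "Ck_on k S f \<Longrightarrow> Ck_on k S g \<Longrightarrow> Ck_on k S (\<lambda>x. f x + g x)"
proof (induction k arbitrary: f g)
  case 0
  then show ?case by (auto intro: continuous_intros)
next
  case (Suc k)
  have d: "((\<lambda>x. f x + g x) has_derivative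
      (\<lambda>u. frechet_derivative f (at x) u + frechet_derivative g (at x) u)) (at x)" if "x \<in> S" for x
    using that Suc.prems by (auto intro!: has_derivative_add differentiable_imp_frechet)
  have "Ck_on k S (\<lambda>x. frechet_derivative (\<lambda>x. f x + g x) (at x) u)" for u
    by (rule Ck_on_cong[OF assms _ Suc.IH[of "\<lambda>x. frechet_derivative f (at x) u" "\<lambda>x. frechet_derivative g (at x) u"]])
      (use Suc.prems frechet_derivative_eqI[OF d] in simp_all)
  then show ?case using d by (auto simp: differentiable_def)
qed

lemma Ck_on_mult:
  fixes f g :: "'e::real_normed_vector \<Rightarrow> real"
  assumes "open S" shows "Ck_on k S f \<Longrightarrow> Ck_on k S g \<Longrightarrow> Ck_on k S (\<lambda>x. f x * g x)"
proof (induction k arbitrary: f g)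
  case 0
  then show ?case by (auto intro: continuous_intros)
next
  case (Suc k)
  have d: "((\<lambda>x. f x * g x) has_derivative
      (\<lambda>u. f x * frechet_derivative g (at x) u + frechet_derivative f (at x) u * g x)) (at x)" if "x \<in> S" for x
    using that Suc.prems by (auto intro!: has_derivative_mult differentiable_imp_frechet)
  \<comment> \<open>The product rule leaves \<open>f\<close> and \<open>g\<close> undifferentiated
    in one factor each; \<open>Ck_on_SucD\<close> lowers their order from \<open>Suc k\<close> to
    \<open>k\<close> for the induction hypothesis.\<close>
  have "Ck_on k S (\<lambda>x. f x * frechet_derivative g (at x) u + frechet_derivative f (at x) u * g x)" for u
    using Suc.prems Ck_on_SucD by (intro Ck_on_add assms Suc.IH) auto
  then have "Ck_on k S (\<lambda>x. frechet_derivative (\<lambda>x. f x * g x) (at x) u)" for u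
    by (rule Ck_on_cong[OF assms, rotated]) (use frechet_derivative_eqI[OF d] in simp)
  then show ?case using d by (auto simp: differentiable_def)
qed

lemma Ck_on_const: "Ck_on k S (\<lambda>x. c)"
  by (induction k arbitrary: c) auto

lemma smooth_on_const: "smooth_on S (\<lambda>x. c)"
  by (simp add: smooth_on_def Ck_on_const)

lemma smooth_on_add: "open S \<Longrightarrow> smooth_on S f \<Longrightarrow> smooth_on S g \<Longrightarrow> smooth_on S (\<lambda>x. f x + g x)"
  by (simp add: smooth_on_def Ck_on_add)

lemma smooth_on_mult:
  fixes f g :: "'e::real_normed_vector \<Rightarrow> real"
  shows "open S \<Longrightarrow> smooth_on S f \<Longrightarrow> smooth_on S g \<Longrightarrow> smooth_on S (\<lambda>x. f x * g x)"
  by (simp add: smooth_on_def Ck_on_mult)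

lemma smooth_on_sum:
  assumes "open S" "\<And>i. i \<in> I \<Longrightarrow> smooth_on S (f i)"
  shows "smooth_on S (\<lambda>x. \<Sum>i\<in>I. f i x)"
  using assms(2)
  by (induction I rule: infinite_finite_induct) (simp_all add: smooth_on_const smooth_on_add assms(1))

lemma smooth_on_cong: "open S \<Longrightarrow> (\<And>x. x \<in> S \<Longrightarrow> f x = g x) \<Longrightarrow> smooth_on S f \<Longrightarrow> smooth_on S g"
  unfolding smooth_on_def using Ck_on_cong by blast

lemma smooth_on_differentiable: "smooth_on S f \<Longrightarrow> x \<in> S \<Longrightarrow> f differentiable (at x)"
  unfolding smooth_on_def by (auto dest!: spec[of _ "Suc 0"])

lemma smooth_on_frechet: "smooth_on S f \<Longrightarrow> smooth_on S (\<lambda>x. frechet_derivative f (at x) u)"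
  unfolding smooth_on_def using Ck_on.simps(2) by blast

section \<open>Mixed second derivatives by the mean value theorem\<close>

lemma DERIV_along_line:
  assumes "f differentiable (at (p + s *\<^sub>R u))"
  shows "((\<lambda>s. f (p + s *\<^sub>R u) :: real) has_field_derivative
           frechet_derivative f (at (p + s *\<^sub>R u)) u) (at s)"
proof -
  have "((\<lambda>s. f (p + s *\<^sub>R u)) has_derivative (\<lambda>h. frechet_derivative f (at (p + s *\<^sub>R u)) (h *\<^sub>R u))) (at s)"
    by (rule has_derivative_compose[where g = f])
      (auto intro!: derivative_eq_intros differentiable_imp_frechet assms)
  moreover have "frechet_derivative f (at (p + s *\<^sub>R u)) (h *\<^sub>R u)
      = frechet_derivative f (at (p + s *\<^sub>R u)) u * h" for h
    using linear_frechet_derivative[OF assms] by (simp add: linear_cmul)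
  ultimately show ?thesis by (simp add: has_field_derivative_def)
qed

text \<open>The mean value theorem is applied twice, first along \<open>u\<close>, then along
  \<open>v\<close>. The bound on \<open>h\<close> keeps the whole parallelogram inside the
  ball.\<close>

lemma second_difference_mvt:
  fixes f :: "'e::real_normed_vector \<Rightarrow> real"
  assumes D1: "\<And>y. y \<in> ball x r \<Longrightarrow> f differentiable (at y)"
    and D2: "\<And>y. y \<in> ball x r \<Longrightarrow> (\<lambda>z. frechet_derivative f (at z) u) differentiable (at y)"
    and h: "0 < h" "h * (norm u + norm v) < r"
  obtains s t where "0 < s" "s < h" "0 < t" "t < h"
    "f (x + h *\<^sub>R u + h *\<^sub>R v) - f (x + h *\<^sub>R u) - f (x + h *\<^sub>R v) + f x =
       h * h * frechet_derivative (\<lambda>z. frechet_derivative f (at z) u) (at (x + s *\<^sub>R u + t *\<^sub>R v)) v"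
proof -
  have ball: "x + s *\<^sub>R u + t *\<^sub>R v \<in> ball x r" if "0 \<le> s" "s \<le> h" "0 \<le> t" "t \<le> h" for s t
  proof -
    have "norm (s *\<^sub>R u + t *\<^sub>R v) \<le> \<bar>s\<bar> * norm u + \<bar>t\<bar> * norm v"
      using norm_triangle_ineq[of "s *\<^sub>R u" "t *\<^sub>R v"] by simp
    also have "\<dots> \<le> h * norm u + h * norm v"
      using that by (intro add_mono mult_right_mono) auto
    finally have "dist (x + s *\<^sub>R u + t *\<^sub>R v) x < r"
      using h by (simp add: dist_norm algebra_simps)
    then show ?thesis by (simp add: dist_commute)
  qed
  \<comment> \<open>The increment of this first difference over \<open>[0, h]\<close> is the second
    difference.\<close>
  let ?\<phi> = "\<lambda>s. f (x + h *\<^sub>R v + s *\<^sub>R u) - f (x + s *\<^sub>R u)"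
  have "\<exists>s. 0 < s \<and> s < h \<and> ?\<phi> h - ?\<phi> 0 = (h - 0) *
      (frechet_derivative f (at (x + h *\<^sub>R v + s *\<^sub>R u)) u - frechet_derivative f (at (x + s *\<^sub>R u)) u)"
  proof (rule MVT2[OF h(1)])
    fix s assume "0 \<le> s" "s \<le> h"
    then show "(?\<phi> has_field_derivative (frechet_derivative f (at (x + h *\<^sub>R v + s *\<^sub>R u)) u
        - frechet_derivative f (at (x + s *\<^sub>R u)) u)) (at s)"
      using ball[of s 0] ball[of s h] h
      by (intro DERIV_diff DERIV_along_line D1) (auto simp: add_ac)
  qed
  then obtain s where s: "0 < s" "s < h" "?\<phi> h - ?\<phi> 0 = h *
      (frechet_derivative f (at (x + s *\<^sub>R u + h *\<^sub>R v)) u - frechet_derivative f (at (x + s *\<^sub>R u)) u)"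
    by (auto simp: add_ac)
  let ?\<psi> = "\<lambda>t. frechet_derivative f (at (x + s *\<^sub>R u + t *\<^sub>R v)) u"
  have "\<exists>t. 0 < t \<and> t < h \<and> ?\<psi> h - ?\<psi> 0 = (h - 0) *
      frechet_derivative (\<lambda>z. frechet_derivative f (at z) u) (at (x + s *\<^sub>R u + t *\<^sub>R v)) v"
    using ball s by (intro MVT2[OF h(1)] DERIV_along_line D2) auto
  then obtain t where "0 < t" "t < h" "?\<psi> h - ?\<psi> 0 = h *
      frechet_derivative (\<lambda>z. frechet_derivative f (at z) u) (at (x + s *\<^sub>R u + t *\<^sub>R v)) v"
    by auto
  with s show thesis
    by (intro that[of s t]) (auto simp: add_ac)
qed

text \<open>The second difference is symmetric in \<open>u\<close> and \<open>v\<close>, so the two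
  mixed derivatives agree at two points arbitrarily near \<open>x\<close>. By continuity they cannot
  differ at \<open>x\<close> itself.\<close>

lemma second_derivative_symmetric:
  fixes f :: "'e::real_normed_vector \<Rightarrow> real"
  assumes U: "open U" "x \<in> U" and f: "smooth_on U f"
  shows "frechet_derivative (\<lambda>z. frechet_derivative f (at z) u) (at x) v
       = frechet_derivative (\<lambda>z. frechet_derivative f (at z) v) (at x) u"
proof (rule ccontr)
  define P where "P = (\<lambda>u v y. frechet_derivative (\<lambda>z. frechet_derivative f (at z) u) (at y) v)"
  assume "\<not> ?thesis"
  \<comment> \<open>Half the supposed gap: two values each moved by less than this cannot
    meet.\<close>
  then have e: "\<bar>P u v x - P v u x\<bar> / 2 > 0" (is "?e > 0") by (simp add: P_def)
  have "smooth_on U (P u v)" for u v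
    unfolding P_def using f smooth_on_frechet by blast
  then have "isCont (P u v) x" for u v
    using U differentiable_imp_continuous_within smooth_on_differentiable by blast
  then have "(P u v \<longlongrightarrow> P u v x) (nhds x)" for u v
    using isCont_def tendsto_at_iff_tendsto_nhds by blast
  then have ev: "\<forall>\<^sub>F y in nhds x. dist (P u' v' y) (P u' v' x) < ?e" for u' v'
    using e by (rule tendstoD)
  have "\<forall>\<^sub>F y in nhds x. y \<in> U"
    using U by (simp add: eventually_nhds_in_open)
  then have "\<forall>\<^sub>F y in nhds x. y \<in> U \<and> dist (P u v y) (P u v x) < ?e \<and> dist (P v u y) (P v u x) < \<bar>P u v x - P v u x\<bar> / 2"
    using ev[of u v] ev[of v u] by eventually_elim simp
  then obtain r where r: "r > 0" "\<And>y. dist y x < r \<Longrightarrow>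
      y \<in> U \<and> dist (P u v y) (P u v x) < ?e \<and> dist (P v u y) (P v u x) < \<bar>P u v x - P v u x\<bar> / 2"
    by (auto simp: eventually_nhds_metric)
  \<comment> \<open>The summand 1 keeps the denominator positive when \<open>u\<close> and
    \<open>v\<close> are 0 and makes the bounds on \<open>h\<close> strict.\<close>
  define h where "h = r / (norm u + norm v + 1)"
  have n: "norm u + norm v + 1 > 0" by (smt (verit) norm_ge_zero)
  have h: "h > 0" "h * (norm u + norm v) < r" "h * (norm v + norm u) < r"
    using r n by (auto simp: h_def field_simps)
  have D1: "f differentiable at y" "(\<lambda>z. frechet_derivative f (at z) w) differentiable (at y)"
    if "y \<in> ball x r" for y w
  proof -
    have "y \<in> U" using that r(2)[of y] by (simp add: dist_commute)
    then show "f differentiable at y" "(\<lambda>z. frechet_derivative f (at z) w) differentiable (at y)"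
      using f smooth_on_frechet smooth_on_differentiable by blast+
  qed
  obtain s t where st: "0 < s" "s < h" "0 < t" "t < h"
    "f (x + h *\<^sub>R u + h *\<^sub>R v) - f (x + h *\<^sub>R u) - f (x + h *\<^sub>R v) + f x = h * h * P u v (x + s *\<^sub>R u + t *\<^sub>R v)"
    using second_difference_mvt[OF D1(1) D1(2) h(1,2)] unfolding P_def by blast
  obtain s' t' where st': "0 < s'" "s' < h" "0 < t'" "t' < h"
    "f (x + h *\<^sub>R v + h *\<^sub>R u) - f (x + h *\<^sub>R v) - f (x + h *\<^sub>R u) + f x = h * h * P v u (x + s' *\<^sub>R v + t' *\<^sub>R u)"
    using second_difference_mvt[OF D1(1) D1(2) h(1,3)] unfolding P_def by blast
  have "h * h * P u v (x + s *\<^sub>R u + t *\<^sub>R v) = h * h * P v u (x + s' *\<^sub>R v + t' *\<^sub>R u)"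
    unfolding st(5)[symmetric] st'(5)[symmetric] by (simp add: add_ac)
  then have eq: "P u v (x + s *\<^sub>R u + t *\<^sub>R v) = P v u (x + s' *\<^sub>R v + t' *\<^sub>R u)"
    using h by simp
  have near: "dist (x + s *\<^sub>R u + t *\<^sub>R v) x < r"
    if "0 < s" "s < h" "0 < t" "t < h" "h * (norm u + norm v) < r" for s t and u v :: 'e
  proof -
    have "norm (s *\<^sub>R u + t *\<^sub>R v) \<le> \<bar>s\<bar> * norm u + \<bar>t\<bar> * norm v"
      using norm_triangle_ineq[of "s *\<^sub>R u" "t *\<^sub>R v"] by simp
    also have "\<dots> \<le> h * norm u + h * norm v"
      using that by (intro add_mono mult_right_mono) auto
    finally show ?thesis using that by (simp add: dist_norm algebra_simps)
  qed
  have "dist (P u v (x + s *\<^sub>R u + t *\<^sub>R v)) (P u v x) < ?e"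
    "dist (P v u (x + s' *\<^sub>R v + t' *\<^sub>R u)) (P v u x) < ?e"
    using r(2) near[OF st(1-4) h(2)] near[OF st'(1-4) h(3)] by blast+
  then show False using eq by (auto simp: dist_real_def abs_if field_simps split: if_splits)
qed

section \<open>The signed shuffle product\<close>


definition contract :: "'e \<Rightarrow> ('e list \<Rightarrow> real) \<Rightarrow> 'e list \<Rightarrow> real" where
  "contract v f = (\<lambda>vs. f (v # vs))"

text \<open>The grade involution. Reading the sign off the length of the list makes the
  antiderivation formulas valid without a homogeneity assumption.\<close>

definition involute :: "('e list \<Rightarrow> real) \<Rightarrow> 'e list \<Rightarrow> real" where
  "involute f = (\<lambda>vs. (-1) ^ length vs * f vs)"

definition shuffle :: "('e list \<Rightarrow> real) \<Rightarrow> ('e list \<Rightarrow> real) \<Rightarrow> 'e list \<Rightarrow> real" where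
  "shuffle f g = (\<lambda>vs. \<Sum>I\<in>Pow {..<length vs}. shuffle_sign I * f (nths vs I) * g (nths vs (- I)))"

lemma wedge_eq_shuffle: "wedge \<alpha> \<beta> c x = shuffle (\<alpha> c x) (\<beta> c x)"
  by (simp add: wedge_def shuffle_def)

text \<open>Position 0 goes either to the first factor or to the second; these cases become the two
  summands of \<open>shuffle_Cons\<close>.\<close>

lemma Pow_lessThan_Suc_shift:
  "Pow {..<Suc n} = (\<lambda>J. insert 0 (Suc ` J)) ` Pow {..<n} \<union> (\<lambda>J. Suc ` J) ` Pow {..<n}"
  unfolding lessThan_Suc_eq_insert_0 Pow_insert image_Pow_surj[OF refl, symmetric]
  by (auto simp: image_image)

text \<open>Nothing lies below position 0, so putting it into the first factor creates no
  inversion.\<close>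

lemma shuffle_sign_insert_0: "shuffle_sign (insert 0 (Suc ` J)) = shuffle_sign J"
proof -
  have "{(i, j). i \<in> insert 0 (Suc ` J) \<and> j \<notin> insert 0 (Suc ` J) \<and> j < i}
      = map_prod Suc Suc ` {(i, j). i \<in> J \<and> j \<notin> J \<and> j < i}" (is "?L = ?R")
  proof (intro set_eqI iffI)
    fix p assume "p \<in> ?L"
    then obtain i j where p: "p = (Suc i, Suc j)" "i \<in> J" "j \<notin> J" "j < i"
      by (cases p, case_tac "snd p") auto
    then show "p \<in> ?R" by force
  qed auto
  then show ?thesis
    by (simp add: shuffle_sign_def card_image map_prod_inj_on[of Suc UNIV Suc UNIV, THEN inj_on_subset])
qed

text \<open>Position 0 now lies outside the set and below all its elements, so each element
  contributes one new inversion.\<close>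

lemma shuffle_sign_Suc_image:
  assumes "finite J" shows "shuffle_sign (Suc ` J) = (-1) ^ card J * shuffle_sign J"
proof -
  let ?P = "{(i, j). i \<in> J \<and> j \<notin> J \<and> j < i}"
  have "{(i, j). i \<in> Suc ` J \<and> j \<notin> Suc ` J \<and> j < i}
      = (\<lambda>i. (Suc i, 0)) ` J \<union> map_prod Suc Suc ` ?P" (is "?L = ?R")
  proof (intro set_eqI iffI)
    fix p assume "p \<in> ?L"
    then obtain i j where p: "p = (Suc i, j)" "i \<in> J" "j \<notin> Suc ` J" "j < Suc i"
      by (cases p) auto
    then show "p \<in> ?R" by (cases j) force+
  qed auto
  moreover have "finite ?P"
    by (rule finite_subset[of _ "Sigma J (\<lambda>i. {..<i})"]) (use assms in auto)
  ultimately have "card {(i, j). i \<in> Suc ` J \<and> j \<notin> Suc ` J \<and> j < i} = card J + card ?P"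
    using assms by (simp add: card_Un_disjoint card_image inj_on_def disjoint_iff
        map_prod_inj_on[of Suc UNIV Suc UNIV, THEN inj_on_subset] image_iff split_paired_all)
  then show ?thesis by (simp add: shuffle_sign_def power_add)
qed

lemma shuffle_Nil: "shuffle f g [] = f [] * g []"
  by (simp add: shuffle_def shuffle_sign_def)

text \<open>Interior multiplication is an antiderivation of the shuffle product; together with
  \<open>shuffle_Nil\<close> this determines the product by recursion on the list of vectors.\<close>

lemma shuffle_Cons:
  "shuffle f g (v # vs) = shuffle (contract v f) g vs + shuffle (involute f) (contract v g) vs"
proof -
  let ?n = "length vs"
  let ?F = "\<lambda>I. shuffle_sign I * f (nths (v # vs) I) * g (nths (v # vs) (- I))"
  let ?ins = "\<lambda>J. insert 0 (Suc ` J)" and ?suc = "\<lambda>J. Suc ` J"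
  have injS: "inj_on ?suc (Pow {..<?n})"
    by (auto simp: inj_on_def inj_image_eq_iff)
  have inj0: "inj_on ?ins (Pow {..<?n})"
  proof (rule inj_onI)
    fix J K assume "?ins J = ?ins K"
    then have "Suc ` J = Suc ` K" by (auto dest: insert_ident[THEN iffD1, rotated 2])
    then show "J = K" by (simp add: inj_image_eq_iff)
  qed
  have "{j. Suc j \<in> insert 0 (Suc ` J)} = J" "{j. Suc j \<in> - insert 0 (Suc ` J)} = - J"
     "{j. Suc j \<in> Suc ` J} = J" "{j. Suc j \<in> - Suc ` J} = - J" for J
    by auto
  then have c: "nths (v # vs) (?ins J) = v # nths vs J" "nths (v # vs) (- ?ins J) = nths vs (- J)"
      "nths (v # vs) (?suc J) = nths vs J" "nths (v # vs) (- ?suc J) = v # nths vs (- J)" for J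
    by (auto simp only: nths_Cons) auto
  \<comment> \<open>Identifies the sign from the new inversions with the sign in
    \<open>involute f\<close>.\<close>
  have card: "length (nths vs J) = card J" if "J \<subseteq> {..<?n}" for J
    using that by (auto simp: length_nths intro!: arg_cong[of _ _ card])
  have "shuffle f g (v # vs) = sum ?F (Pow {..<Suc ?n})"
    by (simp add: shuffle_def)
  also have "\<dots> = sum ?F (?ins ` Pow {..<?n}) + sum ?F (?suc ` Pow {..<?n})"
    unfolding Pow_lessThan_Suc_shift by (rule sum.union_disjoint) auto
  also have "sum ?F (?ins ` Pow {..<?n}) = shuffle (contract v f) g vs"
    unfolding sum.reindex[OF inj0] shuffle_def
    by (rule sum.cong) (simp_all only: o_def c, simp_all add: shuffle_sign_insert_0 contract_def)
  also have "sum ?F (?suc ` Pow {..<?n}) = shuffle (involute f) (contract v g) vs"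
    unfolding sum.reindex[OF injS] shuffle_def
    by (rule sum.cong) (simp_all only: o_def c, auto simp: shuffle_sign_Suc_image contract_def
        involute_def card finite_subset[of _ "{..<?n}"])
  finally show ?thesis .
qed

section \<open>Algebraic laws of the shuffle product\<close>

lemma contract_shuffle:
  "contract v (shuffle f g) = shuffle (contract v f) g + shuffle (involute f) (contract v g)"
  by (simp add: fun_eq_iff contract_def[of v "shuffle f g"] shuffle_Cons)

lemma shuffle_add_left: "shuffle (f + f') g = shuffle f g + shuffle f' g"
  by (simp add: fun_eq_iff shuffle_def algebra_simps sum.distrib)

lemma shuffle_add_right: "shuffle f (g + g') = shuffle f g + shuffle f g'"
  by (simp add: fun_eq_iff shuffle_def algebra_simps sum.distrib)

lemma shuffle_scale_left: "shuffle (\<lambda>vs. a * f vs) g = (\<lambda>vs. a * shuffle f g vs)"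
  by (simp add: fun_eq_iff shuffle_def algebra_simps sum_distrib_left)

lemma shuffle_scale_right: "shuffle f (\<lambda>vs. a * g vs) = (\<lambda>vs. a * shuffle f g vs)"
  by (simp add: fun_eq_iff shuffle_def algebra_simps sum_distrib_left)

lemma shuffle_minus_left: "shuffle (- f) g = - shuffle f g"
  by (simp add: fun_eq_iff shuffle_def sum_negf)

lemma shuffle_minus_right: "shuffle f (- g) = - shuffle f g"
  by (simp add: fun_eq_iff shuffle_def sum_negf)

lemma contract_involute: "contract v (involute f) = - involute (contract v f)"
  by (simp add: fun_eq_iff contract_def involute_def)

lemma involute_involute: "involute (involute f) = f"
  by (simp add: fun_eq_iff involute_def flip: power_mult_distrib mult.assoc)

lemma contract_add: "contract v (f + g) = contract v f + contract v g"
  by (simp add: fun_eq_iff contract_def)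

lemma involute_shuffle: "involute (shuffle f g) = shuffle (involute f) (involute g)"
proof
  fix vs show "involute (shuffle f g) vs = shuffle (involute f) (involute g) vs"
  proof (induction vs arbitrary: f g)
    case Nil
    then show ?case by (simp add: involute_def shuffle_Nil)
  next
    case (Cons v vs)
    have "involute (shuffle f g) (v # vs) = - involute (shuffle (contract v f) g) vs
        - involute (shuffle (involute f) (contract v g)) vs"
      by (simp add: involute_def shuffle_Cons algebra_simps)
    then show ?case
      by (simp add: Cons.IH shuffle_Cons contract_involute shuffle_minus_left shuffle_minus_right)
  qed
qed

text \<open>Contracting either side gives three terms, one for each factor that receives the vector,
  with \<open>involute\<close> applied to the factors passed over. That \<open>involute\<close> is
  multiplicative matches the third term.\<close>

lemma shuffle_assoc: "shuffle (shuffle f g) h = shuffle f (shuffle g h)"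
proof
  fix vs show "shuffle (shuffle f g) h vs = shuffle f (shuffle g h) vs"
    by (induction vs arbitrary: f g h)
      (simp_all add: shuffle_Nil shuffle_Cons contract_shuffle involute_shuffle
        shuffle_add_left shuffle_add_right)
qed

definition homogeneous :: "nat \<Rightarrow> ('e list \<Rightarrow> real) \<Rightarrow> bool" where
  "homogeneous p f \<longleftrightarrow> (\<forall>vs. length vs \<noteq> p \<longrightarrow> f vs = 0)"

lemma homogeneous_contract: "homogeneous (Suc p) f \<Longrightarrow> homogeneous p (contract v f)"
  by (simp add: homogeneous_def contract_def)

lemma homogeneous_0_contract: "homogeneous 0 f \<Longrightarrow> contract v f = 0"
  by (simp add: homogeneous_def contract_def fun_eq_iff)

lemma involute_homogeneous: "homogeneous p f \<Longrightarrow> involute f = (\<lambda>vs. (-1) ^ p * f vs)"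
  by (auto simp: homogeneous_def involute_def fun_eq_iff)

lemma shuffle_zero_left [simp]: "shuffle 0 g = 0"
  by (simp add: fun_eq_iff shuffle_def)

lemma shuffle_zero_right [simp]: "shuffle f 0 = 0"
  by (simp add: fun_eq_iff shuffle_def)

lemma shuffle_graded_commute:
  assumes "homogeneous p f" "homogeneous q g"
  shows "shuffle f g vs = (-1) ^ (p * q) * shuffle g f vs"
  using assms
proof (induction vs arbitrary: p q f g)
  case Nil
  then show ?case by (cases "p = 0"; cases "q = 0") (simp_all add: shuffle_Nil homogeneous_def)
next
  case (Cons v vs)
  \<comment> \<open>The exponent is \<open>(p - 1) * q\<close> up to parity, written as a sum to
    avoid truncated subtraction. For \<open>p = 0\<close> both sides vanish.\<close>
  have 1: "shuffle (contract v f) g vs = (-1) ^ (p * q + q) * shuffle g (contract v f) vs"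
  proof (cases p)
    case 0
    then show ?thesis using Cons.prems by (simp add: homogeneous_0_contract)
  next
    case (Suc p')
    then show ?thesis using Cons.IH[OF homogeneous_contract, of p' f q g v] Cons.prems
      by (simp add: power_add algebra_simps flip: power_mult_distrib)
  qed
  have 2: "shuffle f (contract v g) vs = (-1) ^ (p * q + p) * shuffle (contract v g) f vs"
  proof (cases q)
    case 0
    then show ?thesis using Cons.prems by (simp add: homogeneous_0_contract)
  next
    case (Suc q')
    then show ?thesis using Cons.IH[OF _ homogeneous_contract, of p f q' g v] Cons.prems
      by (simp add: power_add algebra_simps flip: power_mult_distrib)
  qed
  \<comment> \<open>One \<open>p\<close> comes from \<open>involute f\<close>, the other from moving
    \<open>f\<close> past the contraction of \<open>g\<close>.\<close>
  have "(-1) ^ (p * q + p + p) = ((-1) ^ (p * q) :: real)"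
    by (simp add: power_add flip: power_mult_distrib)
  then show ?case
    by (simp add: shuffle_Cons involute_homogeneous[OF Cons.prems(1)] involute_homogeneous[OF Cons.prems(2)]
        shuffle_scale_left 1 2 power_add distrib_left mult.assoc mult.left_commute[of "(-1) ^ p"])
qed

section \<open>Alternating forms\<close>


definition altform :: "nat \<Rightarrow> ('e::real_vector list \<Rightarrow> real) \<Rightarrow> bool" where
  "altform k f \<longleftrightarrow> homogeneous k f \<and> alternating_multilinear k f"

lemma altform_0: "altform 0 f \<longleftrightarrow> (\<forall>v. contract v f = 0)"
  by (simp add: altform_def homogeneous_def alternating_multilinear_def contract_def fun_eq_iff)
    (metis length_0_conv neq_Nil_conv list.distinct(1))

lemma altform_contract_linear:
  assumes "altform (Suc k) f"
  shows "contract (u + v) f = contract u f + contract v f"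
    and "contract (a *\<^sub>R v) f = (\<lambda>vs. a * contract v f vs)"
    and "contract v (contract v f) = 0"
    and "altform k (contract v f)"
proof -
  have hom: "f vs = 0" if "length vs \<noteq> Suc k" for vs
    using assms that by (simp add: altform_def homogeneous_def)
  have lin: "linear (\<lambda>v. f (vs[i := v]))" if "length vs = Suc k" "i < Suc k" for vs i
    using assms that by (simp add: altform_def alternating_multilinear_def)
  have alt: "f vs = 0" if "length vs = Suc k" "i < j" "j < Suc k" "vs ! i = vs ! j" for vs i j
    using assms that unfolding altform_def alternating_multilinear_def by blast
  have lin0: "linear (\<lambda>v. f (v # vs))" if "length vs = k" for vs
    using lin[of "0 # vs" 0] that by simp
  show "contract (u + v) f = contract u f + contract v f"
  proof
    fix vs show "contract (u + v) f vs = (contract u f + contract v f) vs"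
      by (cases "length vs = k") (simp_all add: contract_def hom linear_add[OF lin0])
  qed
  show "contract (a *\<^sub>R v) f = (\<lambda>vs. a * contract v f vs)"
  proof
    fix vs show "contract (a *\<^sub>R v) f vs = a * contract v f vs"
      by (cases "length vs = k") (simp_all add: contract_def hom linear_cmul[OF lin0])
  qed
  show "contract v (contract v f) = 0"
  proof
    fix vs show "contract v (contract v f) vs = 0 vs"
      using alt[of "v # v # vs" 0 1] hom[of "v # v # vs"]
      by (cases "Suc (length vs) = k") (auto simp: contract_def)
  qed
  show "altform k (contract v f)"
    unfolding altform_def homogeneous_def alternating_multilinear_def
  proof (intro conjI allI impI)
    fix vs :: "'a list" assume "length vs \<noteq> k"
    then show "contract v f vs = 0" by (simp add: contract_def hom)
  next
    fix vs :: "'a list" and i assume "length vs = k \<and> i < k"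
    then show "linear (\<lambda>x. contract v f (vs[i := x]))"
      using lin[of "v # vs" "Suc i"] by (simp add: contract_def)
  next
    fix vs :: "'a list" and i j assume "length vs = k \<and> i < j \<and> j < k \<and> vs ! i = vs ! j"
    then show "contract v f vs = 0"
      using alt[of "v # vs" "Suc i" "Suc j"] by (simp add: contract_def)
  qed
qed

lemma altform_Nil: "altform (Suc k) f \<Longrightarrow> f [] = 0"
  by (simp add: altform_def homogeneous_def)

text \<open>Makes alternation accessible to induction on the degree: the contractions handle pairs
  of slots that avoid slot 0, \<open>alt\<close> handles slots 0 and 1, and the remaining pairs
  reduce to these by a swap.\<close>

lemma altform_SucI:
  assumes nil: "f [] = 0"
    and add: "\<And>u v. contract (u + v) f = contract u f + contract v f"
    and scale: "\<And>a v. contract (a *\<^sub>R v) f = (\<lambda>vs. a * contract v f vs)"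
    and alt: "\<And>v. contract v (contract v f) = 0"
    and contract: "\<And>v. altform k (contract v f)"
  shows "altform (Suc k) f"
  unfolding altform_def homogeneous_def alternating_multilinear_def
proof (intro conjI allI impI)
  have Cons: "f (v # vs) = contract v f vs" for v vs
    by (simp add: contract_def)
  fix vs :: "'a list"
  show "f vs = 0" if "length vs \<noteq> Suc k"
    using that nil contract by (cases vs) (auto simp: altform_def homogeneous_def Cons)
  fix i
  show "linear (\<lambda>v. f (vs[i := v]))" if i: "length vs = Suc k \<and> i < Suc k"
  proof -
    obtain w ws where vs: "vs = w # ws" "length ws = k"
      using i by (cases vs) auto
    show ?thesis
    proof (cases i)
      case 0
      then show ?thesis by (auto simp: vs Cons add scale intro!: linearI)
    next
      case (Suc i')
      then show ?thesis
        using contract[of w] vs i by (auto simp: Cons altform_def alternating_multilinear_def)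
    qed
  qed
  fix j
  show "f vs = 0" if ij: "length vs = Suc k \<and> i < j \<and> j < Suc k \<and> vs ! i = vs ! j"
  proof -
    obtain w ws j' where vs: "vs = w # ws" "length ws = k" "j = Suc j'" "j' < k"
      using ij by (cases vs; cases j) auto
    have rec: "contract x f us = 0" if "length us = k" "i' < j''" "j'' < k" "us ! i' = us ! j''" for x us i' j''
      using contract[of x] that unfolding altform_def alternating_multilinear_def by blast
    show ?thesis
    proof (cases i)
      case (Suc i')
      then show ?thesis using rec[of ws i' j' w] ij vs by (auto simp: Cons)
    next
      case 0
      obtain x us where ws: "ws = x # us"
        using vs by (cases ws) auto
      show ?thesis
      proof (cases j')
        case 0
        then show ?thesis
          using alt[of w] \<open>i = 0\<close> ij vs ws by (auto simp: contract_def fun_eq_iff)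
      next
        case (Suc j'')
        have 1: "f ((u + v) # ys) = f (u # ys) + f (v # ys)" for u v ys
          using fun_cong[OF add[of u v], of ys] by (simp add: contract_def)
        have 2: "f (y # (u + v) # ys) = f (y # u # ys) + f (y # v # ys)" for u v y ys
          using fun_cong[OF altform_contract_linear(1)[of "k - 1" "contract y f" u v], of ys] contract[of y] vs
          by (simp add: contract_def)
        have 3: "f (y # y # ys) = 0" for y ys
          using fun_cong[OF alt[of y], of ys] by (simp add: contract_def)
        \<comment> \<open>Polarisation of the vanishing on equal first two vectors. After this swap
          the repeated vector \<open>w\<close> sits in slots 1 and \<open>j\<close>, hence inside
          the contraction by \<open>x\<close>.\<close>
        have "f (w # x # us) + f (x # w # us) = 0"
          using 3[of "w + x" us] 3[of w us] 3[of x us] unfolding 1 2 by simp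
        moreover have "contract x f (w # us) = 0"
          using rec[of "w # us" 0 "j'" x] Suc ij vs ws \<open>i = 0\<close> by simp
        ultimately show ?thesis by (simp add: vs ws contract_def)
      qed
    qed
  qed
qed

lemma altform_zero: "altform k 0"
  by (simp add: altform_def homogeneous_def alternating_multilinear_def linear_zero)

text \<open>In degree 0 the contraction is 0, which is alternating of every degree, so truncated
  subtraction is harmless and inductions over lists need no case split.\<close>

lemma altform_contract: "altform k f \<Longrightarrow> altform (k - 1) (contract v f)"
  by (cases k) (simp_all add: altform_0 altform_zero altform_contract_linear(4))

lemma altform_linear: "altform k f \<Longrightarrow> linear (\<lambda>v. contract v f vs)"
  by (cases k) (auto simp: altform_0 altform_contract_linear intro!: linearI)

lemma altform_contract_add: "altform k f \<Longrightarrow> contract (u + v) f = contract u f + contract v f"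
  by (cases k) (simp_all add: altform_0 altform_contract_linear)

lemma altform_contract_scale: "altform k f \<Longrightarrow> contract (a *\<^sub>R v) f = (\<lambda>vs. a * contract v f vs)"
  by (cases k) (auto simp: altform_0 altform_contract_linear)

lemma altform_contract_contract: "altform k f \<Longrightarrow> contract v (contract v f) = 0"
  by (cases k) (simp_all add: altform_0 altform_contract_linear, simp add: contract_def fun_eq_iff)

lemma altform_swap:
  assumes "altform k f" shows "f (u # v # ws) = - f (v # u # ws)"
proof -
  have 1: "f ((x + y) # ys) = f (x # ys) + f (y # ys)" for x y ys
    using fun_cong[OF altform_contract_add[OF assms]] by (simp add: contract_def)
  have 2: "f (z # (x + y) # ys) = f (z # x # ys) + f (z # y # ys)" for x y z ys
    using fun_cong[OF altform_contract_add[OF altform_contract[OF assms]]] by (simp add: contract_def)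
  have 3: "f (x # x # ys) = 0" for x ys
    using fun_cong[OF altform_contract_contract[OF assms]] by (simp add: contract_def)
  show ?thesis using 3[of "u + v" ws] 3[of u ws] 3[of v ws] unfolding 1 2 by simp
qed

lemma altform_add:
  assumes "altform k f" "altform k g" shows "altform k (f + g)"
  using assms unfolding altform_def homogeneous_def alternating_multilinear_def
  by (auto intro: linear_compose_add)

lemma altform_scale: "altform k f \<Longrightarrow> altform k (\<lambda>vs. a * f vs)"
  unfolding altform_def homogeneous_def alternating_multilinear_def
  using linear_compose_scale_right[of "\<lambda>v. f (_[_ := v])" a] by auto

lemma altform_minus: "altform k f \<Longrightarrow> altform k (- f)"
  using altform_scale[of k f "-1"] by (simp add: fun_Compl_def)

lemma altform_involute: "altform k f \<Longrightarrow> altform k (involute f)"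
  using altform_scale[of k f "(-1) ^ k"] involute_homogeneous[of k f] by (simp add: altform_def)

lemma contract_zero [simp]: "contract v 0 = 0"
  by (simp add: contract_def fun_eq_iff)

text \<open>Induction on the total degree, since a contraction lowers the degree of one factor or
  the other.\<close>

lemma altform_shuffle:
  assumes "altform p f" "altform q g" shows "altform (p + q) (shuffle f g)"
  using assms
proof (induction "p + q" arbitrary: p q f g)
  case 0
  then show ?case by (simp add: altform_0 contract_shuffle)
next
  case (Suc n)
  have "altform (Suc n) (shuffle f g)"
  proof (rule altform_SucI)
    show "shuffle f g [] = 0"
      using Suc by (cases p; cases q) (auto simp: shuffle_Nil altform_Nil)
    show "contract (u + v) (shuffle f g) = contract u (shuffle f g) + contract v (shuffle f g)" for u v
      by (simp add: contract_shuffle altform_contract_add[OF Suc.prems(1)] altform_contract_add[OF Suc.prems(2)]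
          shuffle_add_left shuffle_add_right add_ac)
    show "contract (a *\<^sub>R v) (shuffle f g) = (\<lambda>vs. a * contract v (shuffle f g) vs)" for a v
      by (simp add: contract_shuffle altform_contract_scale[OF Suc.prems(1)]
          altform_contract_scale[OF Suc.prems(2)] shuffle_scale_left shuffle_scale_right distrib_left)
        (simp add: fun_eq_iff distrib_left)
    \<comment> \<open>The two mixed terms, in which each factor is contracted once, cancel because
      contraction anticommutes with \<open>involute\<close>.\<close>
    show "contract v (contract v (shuffle f g)) = 0" for v
      by (simp add: contract_shuffle contract_add contract_involute involute_involute shuffle_minus_left
          altform_contract_contract[OF Suc.prems(1)] altform_contract_contract[OF Suc.prems(2)])
    show "altform n (contract v (shuffle f g))" for v
      unfolding contract_shuffle
    proof (rule altform_add)
      show "altform n (shuffle (contract v f) g)"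
      proof (cases p)
        case 0
        then show ?thesis using Suc.prems by (simp add: altform_0 altform_zero)
      next
        case (Suc p')
        then show ?thesis
          using Suc.hyps(1)[of p' q "contract v f" g] Suc.hyps(2) Suc.prems altform_contract[of p f v] by simp
      qed
      show "altform n (shuffle (involute f) (contract v g))"
      proof (cases q)
        case 0
        then show ?thesis using Suc.prems by (simp add: altform_0 altform_zero)
      next
        case (Suc q')
        then show ?thesis
          using Suc.hyps(1)[of p q' "involute f" "contract v g"] Suc.hyps(2) Suc.prems
            altform_contract[of q g v] altform_involute[OF Suc.prems(1)] by simp
      qed
    qed
  qed
  then show ?case using Suc.hyps by simp
qed

text \<open>Every multilinear form is determined by its values on lists of spanning vectors, and on more
  vectors than the spanning set has elements one of them repeats.\<close>

lemma altform_eq_0_if_on_spanning_set: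
  fixes B :: "'e::real_vector set" and f :: "'e list \<Rightarrow> real"
  assumes "span B = UNIV" "altform k f" "\<And>bs. set bs \<subseteq> B \<Longrightarrow> f bs = 0"
  shows "f vs = 0"
  using assms(2,3)
proof (induction vs arbitrary: k f)
  case Nil
  then show ?case by simp
next
  case (Cons v vs)
  have "contract v f vs = 0"
  proof (rule linear_eq_0_on_span[OF altform_linear[OF Cons.prems(1)]])
    show "contract b f vs = 0" if "b \<in> B" for b
      using Cons.IH[OF altform_contract, of k f b] Cons.prems that by (simp add: contract_def)
  qed (simp add: assms(1))
  then show ?case by (simp add: contract_def)
qed

lemma altform_above_dim:
  fixes B :: "'e::real_vector set" and f :: "'e list \<Rightarrow> real"
  assumes "span B = UNIV" "finite B" "card B < k" "altform k f"
  shows "f = 0"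
proof
  fix vs show "f vs = 0 vs"
  proof (subst zero_fun_apply, rule altform_eq_0_if_on_spanning_set[OF assms(1) assms(4)])
    fix bs assume bs: "set bs \<subseteq> B"
    show "f bs = 0"
    proof (cases "length bs = k")
      case True
      then have "\<not> distinct bs"
        using bs assms by (metis card_mono distinct_card leD)
      then obtain i j where "i < j" "j < k" "bs ! i = bs ! j"
        using True by (metis distinct_conv_nth nat_neq_iff)
      then show ?thesis
        using assms(4) True unfolding altform_def alternating_multilinear_def by blast
    qed (use assms(4) in \<open>simp add: altform_def homogeneous_def\<close>)
  qed
qed

section \<open>The exterior derivative on an open set\<close>


text \<open>The value 0 off \<open>U\<close>, also used by \<open>local_d\<close>, lets identities
  hold as equations between total functions.\<close>

definition dir_deriv :: "'e::real_inner set \<Rightarrow> 'e \<Rightarrow> ('e \<Rightarrow> 'e list \<Rightarrow> real) \<Rightarrow> 'e \<Rightarrow> 'e list \<Rightarrow> real" where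
  "dir_deriv U v F = (\<lambda>x vs. if x \<in> U then frechet_derivative (\<lambda>y. F y vs) (at x) v else 0)"

definition local_d :: "'e::real_inner set \<Rightarrow> ('e \<Rightarrow> 'e list \<Rightarrow> real) \<Rightarrow> 'e \<Rightarrow> 'e list \<Rightarrow> real" where
  "local_d U F = (\<lambda>x vs. if x \<in> U
     then \<Sum>i<length vs. (-1) ^ i *
            frechet_derivative (\<lambda>y. F y (take i vs @ drop (Suc i) vs)) (at x) (vs ! i)
     else 0)"

definition smooth_field :: "'e::real_inner set \<Rightarrow> ('e \<Rightarrow> 'e list \<Rightarrow> real) \<Rightarrow> bool" where
  "smooth_field U F \<longleftrightarrow> open U \<and> (\<forall>vs. smooth_on U (\<lambda>x. F x vs))"

lemma ext_d_eq_local_d: "ext_d \<omega> c = local_d (chart_image c) (\<omega> c)"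
  by (simp add: ext_d_def local_d_def fun_eq_iff)

lemma local_d_Nil: "local_d U F x [] = 0"
  by (simp add: local_d_def)

text \<open>Cartan's formula for a constant vector field: interior multiplication followed by d, plus d
  followed by interior multiplication, is the directional derivative.\<close>

lemma local_d_Cons:
  "local_d U F x (v # vs) = dir_deriv U v F x vs - local_d U (\<lambda>x. contract v (F x)) x vs"
  by (simp add: local_d_def dir_deriv_def contract_def sum.lessThan_Suc_shift sum_negf
      del: sum.lessThan_Suc)

lemma contract_local_d:
  "contract v (local_d U F x) = dir_deriv U v F x - local_d U (\<lambda>x. contract v (F x)) x"
  by (simp add: fun_eq_iff contract_def[of v "local_d U F x"] local_d_Cons)

lemma smooth_field_contract: "smooth_field U F \<Longrightarrow> smooth_field U (\<lambda>x. contract v (F x))"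
  by (simp add: smooth_field_def contract_def)

lemma smooth_field_scale: "smooth_field U F \<Longrightarrow> smooth_field U (\<lambda>x vs. a vs * F x vs)"
  by (simp add: smooth_field_def smooth_on_mult smooth_on_const)

lemma smooth_field_involute: "smooth_field U F \<Longrightarrow> smooth_field U (\<lambda>x. involute (F x))"
  using smooth_field_scale[of U F "\<lambda>vs. (-1) ^ length vs"] by (simp add: involute_def)

lemma smooth_field_add: "smooth_field U F \<Longrightarrow> smooth_field U G \<Longrightarrow> smooth_field U (\<lambda>x. F x + G x)"
  by (simp add: smooth_field_def smooth_on_add)

lemma smooth_field_minus: "smooth_field U F \<Longrightarrow> smooth_field U (\<lambda>x. - F x)"
  using smooth_field_scale[of U F "\<lambda>_. -1"] by (simp add: fun_Compl_def)

lemma smooth_field_shuffle: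
  "smooth_field U F \<Longrightarrow> smooth_field U G \<Longrightarrow> smooth_field U (\<lambda>x. shuffle (F x) (G x))"
  by (auto simp: smooth_field_def shuffle_def intro!: smooth_on_sum smooth_on_mult smooth_on_const)

lemma smooth_field_dir_deriv: "smooth_field U F \<Longrightarrow> smooth_field U (dir_deriv U v F)"
  unfolding smooth_field_def dir_deriv_def
proof (intro conjI allI)
  assume F: "open U \<and> (\<forall>vs. smooth_on U (\<lambda>x. F x vs))"
  then show "open U" ..
  show "smooth_on U (\<lambda>x. if x \<in> U then frechet_derivative (\<lambda>y. F y vs) (at x) v else 0)" for vs
    by (rule smooth_on_cong[of U "\<lambda>x. frechet_derivative (\<lambda>y. F y vs) (at x) v"])
      (use F smooth_on_frechet in auto)
qed

lemma smooth_field_local_d: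
  assumes "smooth_field U F" shows "smooth_field U (local_d U F)"
proof -
  have "smooth_on U (\<lambda>x. local_d U F x vs)" for vs
    using assms
  proof (induction vs arbitrary: F)
    case Nil
    then show ?case by (simp add: local_d_Nil smooth_on_const)
  next
    case (Cons v vs)
    have "smooth_on U (\<lambda>x. dir_deriv U v F x vs + (-1) * local_d U (\<lambda>x. contract v (F x)) x vs)"
      using Cons smooth_field_dir_deriv[of U F v] smooth_field_contract[of U F v]
      by (intro smooth_on_add smooth_on_mult smooth_on_const) (simp_all add: smooth_field_def)
    then show ?case by (simp add: local_d_Cons)
  qed
  then show ?thesis using assms by (simp add: smooth_field_def)
qed

lemma smooth_field_has_derivative:
  "smooth_field U F \<Longrightarrow> x \<in> U \<Longrightarrow> ((\<lambda>y. F y vs) has_derivative (\<lambda>v. dir_deriv U v F x vs)) (at x)"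
  using smooth_on_differentiable[of U "\<lambda>y. F y vs" x]
  by (auto simp: smooth_field_def dir_deriv_def dest: differentiable_imp_frechet)

lemma dir_deriv_eqI:
  assumes "\<And>x vs. x \<in> U \<Longrightarrow> ((\<lambda>y. F y vs) has_derivative (\<lambda>v. F' v x vs)) (at x)"
    and "\<And>x vs. x \<notin> U \<Longrightarrow> F' v x vs = 0"
  shows "dir_deriv U v F = F' v"
  by (auto simp: fun_eq_iff dir_deriv_def assms frechet_derivative_eqI[OF assms(1)])

lemma dir_deriv_outside: "x \<notin> U \<Longrightarrow> dir_deriv U v F x = 0"
  by (simp add: dir_deriv_def fun_eq_iff)

lemma local_d_outside: "x \<notin> U \<Longrightarrow> local_d U F x = 0"
  by (simp add: local_d_def fun_eq_iff)

lemma dir_deriv_add: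
  assumes "smooth_field U F" "smooth_field U G"
  shows "dir_deriv U v (\<lambda>x. F x + G x) = (\<lambda>x. dir_deriv U v F x + dir_deriv U v G x)"
  by (rule dir_deriv_eqI)
    (auto simp: dir_deriv_outside intro!: has_derivative_add smooth_field_has_derivative assms)

lemma dir_deriv_scale:
  assumes "smooth_field U F"
  shows "dir_deriv U v (\<lambda>x vs. a vs * F x vs) = (\<lambda>x vs. a vs * dir_deriv U v F x vs)"
  by (rule dir_deriv_eqI)
    (auto simp: dir_deriv_outside intro!: has_derivative_mult_right smooth_field_has_derivative assms)

lemma dir_deriv_shuffle:
  assumes "smooth_field U F" "smooth_field U G"
  shows "dir_deriv U v (\<lambda>x. shuffle (F x) (G x)) =
    (\<lambda>x. shuffle (dir_deriv U v F x) (G x) + shuffle (F x) (dir_deriv U v G x))"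
  by (rule dir_deriv_eqI)
    (auto simp: dir_deriv_outside shuffle_def algebra_simps simp flip: sum.distrib
      intro!: derivative_eq_intros smooth_field_has_derivative[OF assms(1)] smooth_field_has_derivative[OF assms(2)])

lemma dir_deriv_commute:
  assumes "smooth_field U F"
  shows "dir_deriv U u (dir_deriv U v F) = dir_deriv U v (dir_deriv U u F)"
proof (intro ext)
  fix x vs
  show "dir_deriv U u (dir_deriv U v F) x vs = dir_deriv U v (dir_deriv U u F) x vs"
  proof (cases "x \<in> U")
    case True
    \<comment> \<open>The default value off \<open>U\<close> does not affect the outer derivative,
      because \<open>U\<close> is an open neighbourhood of \<open>x\<close>.\<close>
    have eq: "dir_deriv U a (dir_deriv U b F) x vs
        = frechet_derivative (\<lambda>z. frechet_derivative (\<lambda>y. F y vs) (at z) b) (at x) a" for a b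
    proof -
      have "frechet_derivative (\<lambda>z. dir_deriv U b F z vs) (at x)
          = frechet_derivative (\<lambda>z. frechet_derivative (\<lambda>y. F y vs) (at z) b) (at x)"
        using smooth_field_dir_deriv[OF assms, of b] assms True
        by (intro frechet_derivative_transform_within_open[of _ _ U] smooth_on_differentiable[of U])
          (auto simp: smooth_field_def dir_deriv_def)
      then show ?thesis using True by (subst dir_deriv_def) simp
    qed
    show ?thesis
      unfolding eq using assms True by (intro second_derivative_symmetric) (auto simp: smooth_field_def)
  qed (simp add: dir_deriv_outside)
qed

section \<open>Commutation rules and the Leibniz rule for the exterior derivative\<close>

lemma local_d_add:
  assumes "smooth_field U F" "smooth_field U G"
  shows "local_d U (\<lambda>x. F x + G x) = (\<lambda>x. local_d U F x + local_d U G x)"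
proof (intro ext)
  fix x vs show "local_d U (\<lambda>x. F x + G x) x vs = (local_d U F x + local_d U G x) vs"
    using assms
    by (induction vs arbitrary: F G)
      (simp_all add: local_d_Nil local_d_Cons dir_deriv_add contract_add smooth_field_contract)
qed

lemma local_d_scale:
  assumes "smooth_field U F"
  shows "local_d U (\<lambda>x vs. a * F x vs) = (\<lambda>x vs. a * local_d U F x vs)"
proof (intro ext)
  have *: "contract v (\<lambda>vs. a * f vs) = (\<lambda>vs. a * contract v f vs)" for v and f :: "'a list \<Rightarrow> real"
    by (simp add: contract_def)
  fix x vs show "local_d U (\<lambda>x vs. a * F x vs) x vs = a * local_d U F x vs"
    using assms
    by (induction vs arbitrary: F)
      (simp_all add: local_d_Nil local_d_Cons dir_deriv_scale[of U _ _ "\<lambda>_. a"] * smooth_field_contract algebra_simps)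
qed

lemma local_d_minus:
  "smooth_field U F \<Longrightarrow> local_d U (\<lambda>x. - F x) = (\<lambda>x. - local_d U F x)"
  using local_d_scale[of U F "-1"] by (simp add: fun_Compl_def)

lemma local_d_zero: "local_d U (\<lambda>x. 0) = (\<lambda>x. 0)"
  by (simp add: local_d_def fun_eq_iff zero_fun_def)

lemma local_d_diff:
  assumes "smooth_field U F" "smooth_field U G"
  shows "local_d U (\<lambda>x. F x - G x) = (\<lambda>x. local_d U F x - local_d U G x)"
  using local_d_add[OF assms(1) smooth_field_minus[OF assms(2)]] by (simp add: local_d_minus assms(2))

lemma dir_deriv_contract: "dir_deriv U w (\<lambda>x. contract v (F x)) x = contract v (dir_deriv U w F x)"
  by (simp add: dir_deriv_def contract_def)

lemma dir_deriv_diff: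
  assumes "smooth_field U F" "smooth_field U G"
  shows "dir_deriv U v (\<lambda>x. F x - G x) = (\<lambda>x. dir_deriv U v F x - dir_deriv U v G x)"
  by (rule dir_deriv_eqI)
    (auto simp: dir_deriv_outside intro!: has_derivative_diff smooth_field_has_derivative assms)

lemma local_d_dir_deriv:
  assumes "smooth_field U F"
  shows "local_d U (dir_deriv U v F) = dir_deriv U v (local_d U F)"
proof (intro ext)
  fix x vs show "local_d U (dir_deriv U v F) x vs = dir_deriv U v (local_d U F) x vs"
    using assms
  proof (induction vs arbitrary: F)
    case Nil
    show ?case by (simp add: local_d_Nil dir_deriv_def)
  next
    case (Cons w ws)
    note smooth = Cons.prems smooth_field_dir_deriv smooth_field_contract smooth_field_local_d
    have "local_d U (dir_deriv U v F) x (w # ws)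
        = dir_deriv U w (dir_deriv U v F) x ws - local_d U (dir_deriv U v (\<lambda>x. contract w (F x))) x ws"
      by (simp add: local_d_Cons dir_deriv_contract[abs_def])
    also have "\<dots> = dir_deriv U v (dir_deriv U w F) x ws - dir_deriv U v (local_d U (\<lambda>x. contract w (F x))) x ws"
      by (simp add: Cons.IH smooth dir_deriv_commute[OF Cons.prems, of w v])
    also have "\<dots> = dir_deriv U v (\<lambda>x. contract w (local_d U F x)) x ws"
      unfolding contract_local_d by (subst dir_deriv_diff) (simp_all add: smooth)
    finally show ?case
      by (simp add: dir_deriv_contract) (simp add: contract_def)
  qed
qed

text \<open>Applying Cartan's formula twice, the contraction of \<open>d d F\<close> by v is the
  v-derivative of \<open>d F\<close>, minus d of the v-derivative of \<open>F\<close>, plus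
  \<open>d d\<close> of the contracted field. The first two terms cancel by
  \<open>local_d_dir_deriv\<close>; the last is the induction hypothesis.\<close>

lemma local_d_local_d:
  assumes "smooth_field U F" shows "local_d U (local_d U F) = (\<lambda>x. 0)"
proof (intro ext)
  fix x vs show "local_d U (local_d U F) x vs = 0 vs"
    using assms
  proof (induction vs arbitrary: F)
    case (Cons v vs)
    note smooth = Cons.prems smooth_field_dir_deriv smooth_field_contract smooth_field_local_d
    show ?case
      using Cons.IH[of "\<lambda>x. contract v (F x)"]
      by (simp add: local_d_Cons contract_local_d local_d_diff smooth local_d_dir_deriv)
  qed (simp add: local_d_Nil)
qed

lemma local_d_involute:
  assumes "smooth_field U F"
  shows "local_d U (\<lambda>x. involute (F x)) = (\<lambda>x. - involute (local_d U F x))"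
proof (intro ext)
  fix x vs show "local_d U (\<lambda>x. involute (F x)) x vs = (- involute (local_d U F x)) vs"
    using assms
  proof (induction vs arbitrary: F)
    case Nil
    then show ?case by (simp add: local_d_Nil involute_def)
  next
    case (Cons v vs)
    then show ?case
      using dir_deriv_scale[of U F v "\<lambda>vs. (-1) ^ length vs"]
      by (simp add: local_d_Cons contract_involute local_d_minus smooth_field_involute smooth_field_contract)
        (simp add: involute_def local_d_Cons algebra_simps)
  qed
qed

text \<open>Contracting both sides and using Cartan's formula yields the same six terms. The
  induction hypothesis serves the pairs in which one factor is contracted; the sign from
  \<open>local_d_involute\<close> is the one produced by contracting past
  \<open>d F\<close>.\<close>

lemma local_d_shuffle:
  assumes "smooth_field U F" "smooth_field U G"
  shows "local_d U (\<lambda>x. shuffle (F x) (G x)) =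
    (\<lambda>x. shuffle (local_d U F x) (G x) + shuffle (involute (F x)) (local_d U G x))"
proof (intro ext)
  fix x vs show "local_d U (\<lambda>x. shuffle (F x) (G x)) x vs
    = (shuffle (local_d U F x) (G x) + shuffle (involute (F x)) (local_d U G x)) vs"
    using assms
  proof (induction vs arbitrary: F G)
    case Nil
    then show ?case by (simp add: local_d_Nil shuffle_Nil)
  next
    case (Cons v vs)
    note smooth = Cons.prems smooth_field_contract smooth_field_involute smooth_field_shuffle
    have diff: "shuffle (f - g) h = shuffle f h - shuffle g h" "shuffle h (f - g) = shuffle h f - shuffle h g"
      for f g h :: "'a list \<Rightarrow> real"
      using shuffle_add_left[of f "- g" h] shuffle_add_right[of h f "- g"]
      by (simp_all add: shuffle_minus_left shuffle_minus_right)
    show ?case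
      by (simp add: local_d_Cons contract_shuffle shuffle_Cons contract_local_d local_d_add smooth Cons.IH
          dir_deriv_shuffle local_d_involute contract_involute involute_involute diff
          shuffle_minus_left[unfolded fun_Compl_def] shuffle_minus_left shuffle_minus_right)
  qed
qed

section \<open>The exterior derivative of an alternating field is alternating\<close>

lemma dir_deriv_linear:
  assumes "smooth_field U F"
  shows "dir_deriv U (u + v) F x = dir_deriv U u F x + dir_deriv U v F x"
    and "dir_deriv U (a *\<^sub>R v) F x = (\<lambda>vs. a * dir_deriv U v F x vs)"
proof -
  have lin: "linear (\<lambda>v. dir_deriv U v F x vs)" for vs
    using has_derivative_linear[OF smooth_field_has_derivative[OF assms]]
    by (cases "x \<in> U") (simp_all add: dir_deriv_outside linear_zero)
  show "dir_deriv U (u + v) F x = dir_deriv U u F x + dir_deriv U v F x"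
    and "dir_deriv U (a *\<^sub>R v) F x = (\<lambda>vs. a * dir_deriv U v F x vs)"
    by (simp_all add: fun_eq_iff linear_add[OF lin] linear_cmul[OF lin])
qed

text \<open>Differentiation along a constant vector commutes with contraction, so every condition of
  \<open>altform_SucI\<close> is inherited from \<open>F\<close>.\<close>

lemma altform_dir_deriv:
  assumes "smooth_field U F" "\<And>x. altform k (F x)" shows "altform k (dir_deriv U v F x)"
  using assms
proof (induction k arbitrary: F x)
  case 0
  then show ?case by (simp add: altform_0 dir_deriv_contract[symmetric]) (simp add: dir_deriv_def fun_eq_iff zero_fun_def)
next
  case (Suc k)
  note lin = altform_contract_linear[OF Suc.prems(2)]
  show ?case
  proof (rule altform_SucI)
    show "dir_deriv U v F x [] = 0"
      by (simp add: dir_deriv_def altform_Nil[OF Suc.prems(2)])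
    show "contract (u + w) (dir_deriv U v F x) = contract u (dir_deriv U v F x) + contract w (dir_deriv U v F x)" for u w
      by (simp add: dir_deriv_contract[symmetric] lin dir_deriv_add Suc.prems smooth_field_contract)
    show "contract (a *\<^sub>R w) (dir_deriv U v F x) = (\<lambda>vs. a * contract w (dir_deriv U v F x) vs)" for a w
      by (simp add: dir_deriv_contract[symmetric] lin dir_deriv_scale Suc.prems smooth_field_contract)
    show "contract w (contract w (dir_deriv U v F x)) = 0" for w
      by (simp add: dir_deriv_contract[symmetric] lin) (simp add: dir_deriv_def fun_eq_iff zero_fun_def)
    show "altform k (contract w (dir_deriv U v F x))" for w
      using Suc.IH[of "\<lambda>x. contract w (F x)" x] Suc.prems
      by (simp add: dir_deriv_contract lin smooth_field_contract)
  qed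
qed

lemma altform_local_d:
  assumes "smooth_field U F" "\<And>x. altform k (F x)" shows "altform (Suc k) (local_d U F x)"
  using assms
proof (induction k arbitrary: F x)
  case 0
  then have "contract v (local_d U F x) = dir_deriv U v F x" for v x
    by (simp add: contract_local_d altform_0 local_d_zero)
  then show ?case
    using altform_dir_deriv[OF 0] by (intro altform_SucI)
      (simp_all add: local_d_Nil dir_deriv_linear[OF 0(1)] altform_0)
next
  case (Suc k)
  note smooth = Suc.prems(1) smooth_field_contract smooth_field_dir_deriv smooth_field_local_d
  note lin = altform_contract_linear[OF Suc.prems(2)]
  show ?case
  proof (rule altform_SucI)
    show "local_d U F x [] = 0" by (simp add: local_d_Nil)
    show "contract (u + w) (local_d U F x) = contract u (local_d U F x) + contract w (local_d U F x)" for u w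
      by (simp add: contract_local_d dir_deriv_linear lin local_d_add smooth)
    show "contract (a *\<^sub>R w) (local_d U F x) = (\<lambda>vs. a * contract w (local_d U F x) vs)" for a w
      by (simp add: contract_local_d dir_deriv_linear lin local_d_scale smooth)
        (simp add: fun_eq_iff algebra_simps)
    have "contract w (f - g) = contract w f - contract w g" for w and f g :: "'a list \<Rightarrow> real"
      by (simp add: contract_def fun_eq_iff)
    \<comment> \<open>By Cartan's formula used twice, the two terms with a w-derivative of the
      contracted field cancel, and a double contraction of \<open>F\<close> by \<open>w\<close> is
      0.\<close>
    then show "contract w (contract w (local_d U F x)) = 0" for w
      by (simp add: contract_local_d lin local_d_zero dir_deriv_contract)
    show "altform (Suc k) (contract w (local_d U F x))" for w
      using altform_add[OF altform_dir_deriv[OF Suc.prems, of w x]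
          altform_minus[OF Suc.IH[of "\<lambda>x. contract w (F x)" x]]]
      by (simp add: contract_local_d lin smooth)
  qed
qed

section \<open>Naturality of the exterior derivative\<close>


text \<open>The derivative of \<open>y \<mapsto> f (map (L y) vs)\<close> for a fixed form f, when b is the derivative of L.\<close>

primrec slot_sum :: "('e \<Rightarrow> 'e) \<Rightarrow> ('e \<Rightarrow> 'e) \<Rightarrow> ('e list \<Rightarrow> real) \<Rightarrow> 'e list \<Rightarrow> real" where
  "slot_sum L b f [] = 0"
| "slot_sum L b f (w # ws) = f (b w # map L ws) + slot_sum L b (contract (L w) f) ws"

lemma slot_sum_add: "slot_sum L b (f + g) vs = slot_sum L b f vs + slot_sum L b g vs"
  by (induction vs arbitrary: f g) (simp_all add: contract_add)

lemma slot_sum_scale: "slot_sum L b (\<lambda>vs. a * f vs) vs = a * slot_sum L b f vs"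
proof (induction vs arbitrary: f)
  case (Cons w ws)
  then show ?case
    using Cons.IH[of "contract (L w) f"] by (simp add: contract_def distrib_left)
qed simp

abbreviation delete_nth :: "nat \<Rightarrow> 'e list \<Rightarrow> 'e list" where
  "delete_nth i vs \<equiv> take i vs @ drop (Suc i) vs"

text \<open>Moving the i-th slot to the front costs the sign \<open>(-1) ^ i\<close>.\<close>

lemma slot_sum_eq_alternating_sum:
  assumes "altform k f"
  shows "slot_sum L b f vs = (\<Sum>i<length vs. (-1) ^ i * f (b (vs ! i) # map L (delete_nth i vs)))"
  using assms
proof (induction vs arbitrary: k f)
  case (Cons w ws)
  have "slot_sum L b (contract (L w) f) ws
      = (\<Sum>i<length ws. (-1) ^ i * f (L w # b (ws ! i) # map L (delete_nth i ws)))"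
    using Cons.IH[OF altform_contract[OF Cons.prems]] by (simp add: contract_def)
  also have "\<dots> = - (\<Sum>i<length ws. (-1) ^ i * f (b (ws ! i) # L w # map L (delete_nth i ws)))"
    by (simp add: altform_swap[OF Cons.prems, of "L w"] sum_negf)
  finally show ?case
    by (simp add: sum.lessThan_Suc_shift sum_negf del: sum.lessThan_Suc)
qed simp

text \<open>This removes the second derivatives of a change of coordinates. Splitting off
  \<open>w\<close>, the term for index 0 is \<open>slot_sum L (B w) f ws\<close>; symmetry of
  \<open>B\<close> and the previous lemma show that the other terms produce the same with opposite
  sign.\<close>

lemma alternating_sum_slot_sum:
  assumes "altform k f" and B: "\<And>u v. B u v = B v u"
  shows "(\<Sum>i<length vs. (-1) ^ i * slot_sum L (B (vs ! i)) f (delete_nth i vs)) = 0"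
  using assms(1)
proof (induction vs arbitrary: k f)
  case (Cons w ws)
  have "(\<Sum>i<length ws. (-1) ^ i * slot_sum L (B (ws ! i)) f (w # delete_nth i ws))
      = (\<Sum>i<length ws. (-1) ^ i * f (B (ws ! i) w # map L (delete_nth i ws)))
      + (\<Sum>i<length ws. (-1) ^ i * slot_sum L (B (ws ! i)) (contract (L w) f) (delete_nth i ws))"
    by (simp add: distrib_left sum.distrib)
  also have "\<dots> = slot_sum L (B w) f ws"
    using Cons.IH[OF altform_contract[OF Cons.prems], of "L w"]
    by (simp add: slot_sum_eq_alternating_sum[OF Cons.prems] B[of _ w])
  finally show ?case
    by (simp add: sum.lessThan_Suc_shift sum_negf del: sum.lessThan_Suc slot_sum.simps)
qed simp

text \<open>The difference of the two sides is orthogonal to \<open>C\<close> and lies in its span,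
  hence to itself. \<open>C\<close> is not normalised and may contain 0, whose coefficient is 0 by
  the convention for division by 0.\<close>

lemma orthogonal_expansion:
  fixes C :: "'e::real_inner set"
  assumes "finite C" "span C = UNIV" "pairwise orthogonal C"
  shows "(\<Sum>b\<in>C. ((z \<bullet> b) / (b \<bullet> b)) *\<^sub>R b) = z"
proof -
  let ?y = "z - (\<Sum>b\<in>C. ((z \<bullet> b) / (b \<bullet> b)) *\<^sub>R b)"
  have "orthogonal ?y c" if "c \<in> C" for c
  proof -
    have "(\<Sum>b\<in>C. ((z \<bullet> b) / (b \<bullet> b)) * (b \<bullet> c)) = (\<Sum>b\<in>C. if b = c then z \<bullet> c else 0)"
      using assms(3) that by (intro sum.cong) (auto simp: pairwise_def orthogonal_def)
    then show ?thesis
      using that assms(1) by (simp add: orthogonal_def inner_diff_left inner_sum_left)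
  qed
  moreover have "?y \<in> span C" unfolding assms(2) by (rule UNIV_I)
  ultimately have "orthogonal ?y ?y" using orthogonal_to_span by blast
  then show ?thesis by (simp add: orthogonal_self)
qed

text \<open>Chain and product rule with base point and vectors varying together. Expanding the first
  vector \<open>L z w\<close> in \<open>C\<close> leaves \<open>z\<close> in scalar coefficients and
  in the field contracted by a fixed \<open>b\<close>, to which the induction hypothesis
  applies.\<close>

lemma pullback_has_derivative:
  fixes C :: "'e::real_inner set" and L :: "'e \<Rightarrow> 'e \<Rightarrow> 'e"
  assumes C: "finite C" "span C = UNIV" "pairwise orthogonal C"
    and F: "smooth_field U F" "\<And>x. altform k (F x)"
    and \<phi>: "(\<phi> has_derivative L y) (at y)" "\<phi> y \<in> U"
    and L: "\<And>w. ((\<lambda>z. L z w) has_derivative (\<lambda>u. B u w)) (at y)"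
  shows "((\<lambda>z. F (\<phi> z) (map (L z) vs)) has_derivative
     (\<lambda>u. dir_deriv U (L y u) F (\<phi> y) (map (L y) vs) + slot_sum (L y) (B u) (F (\<phi> y)) vs)) (at y)"
  using F
proof (induction vs arbitrary: k F)
  case Nil
  show ?case
    using has_derivative_compose[OF \<phi>(1) smooth_field_has_derivative[OF Nil(1) \<phi>(2)]] by simp
next
  case (Cons w ws)
  let ?c = "\<lambda>b z. (z \<bullet> b) / (b \<bullet> b)"
  have expand: "(\<Sum>b\<in>C. ?c b z * g b) = g z" if "linear g" for g :: "'e \<Rightarrow> real" and z
  proof -
    have "g z = g (\<Sum>b\<in>C. ?c b z *\<^sub>R b)"
      by (simp add: orthogonal_expansion[OF C])
    also have "\<dots> = (\<Sum>b\<in>C. ?c b z * g b)"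
      using that by (simp add: linear_sum linear_cmul)
    finally show ?thesis by simp
  qed
  have lin_F: "linear (\<lambda>b. contract b (F x) xs)" for x xs
    by (rule altform_linear[OF Cons.prems(2)])
  have lin_D: "linear (\<lambda>b. contract b (dir_deriv U v F x) xs)" for v x xs
    by (rule altform_linear[OF altform_dir_deriv[OF Cons.prems]])
  have lin_S: "linear (\<lambda>b. slot_sum (L y) \<beta> (contract b (F x)) xs)" for \<beta> x xs
    by (rule linearI)
      (simp_all add: altform_contract_add[OF Cons.prems(2)] altform_contract_scale[OF Cons.prems(2)]
        slot_sum_add slot_sum_scale)
  let ?D = "\<lambda>b u. contract b (dir_deriv U (L y u) F (\<phi> y)) (map (L y) ws)
      + slot_sum (L y) (B u) (contract b (F (\<phi> y))) ws"
  have IH: "((\<lambda>z. contract b (F (\<phi> z)) (map (L z) ws)) has_derivative ?D b) (at y)" for b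
    using Cons.IH[OF smooth_field_contract[OF Cons.prems(1)] altform_contract[OF Cons.prems(2)]]
    by (simp add: dir_deriv_contract)
  have c: "((\<lambda>z. ?c b (L z w)) has_derivative (\<lambda>u. ?c b (B u w))) (at y)" for b
    unfolding divide_inverse by (intro has_derivative_mult_left has_derivative_inner_left L)
  have "((\<lambda>z. \<Sum>b\<in>C. ?c b (L z w) * contract b (F (\<phi> z)) (map (L z) ws)) has_derivative
      (\<lambda>u. \<Sum>b\<in>C. ?c b (L y w) * ?D b u + ?c b (B u w) * contract b (F (\<phi> y)) (map (L y) ws))) (at y)"
    by (intro has_derivative_sum has_derivative_mult c IH)
  moreover have "(\<Sum>b\<in>C. ?c b (L z w) * contract b (F (\<phi> z)) (map (L z) ws)) = F (\<phi> z) (map (L z) (w # ws))" for z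
    using expand[OF lin_F] by (simp add: contract_def)
  \<comment> \<open>Each of the three sums is the expansion of a functional linear in
    \<open>b\<close>, so it reassembles to that functional's value at the expanded vector.\<close>
  moreover have "(\<Sum>b\<in>C. ?c b (L y w) * ?D b u + ?c b (B u w) * contract b (F (\<phi> y)) (map (L y) ws))
     = dir_deriv U (L y u) F (\<phi> y) (map (L y) (w # ws)) + slot_sum (L y) (B u) (F (\<phi> y)) (w # ws)" for u
    unfolding sum.distrib distrib_left expand[OF lin_F] expand[OF lin_D] expand[OF lin_S]
    by (simp add: contract_def)
  ultimately show ?case by simp
qed

text \<open>The mean value argument is scalar, so it is applied to the inner products of the map
  with a fixed vector. Choosing the difference of the two sides as that vector shows that its norm
  is 0.\<close>

lemma frechet_derivative_vector_symmetric:
  fixes \<phi> :: "'e::real_inner \<Rightarrow> 'e"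
  assumes V: "open V" "y \<in> V" and \<phi>: "smooth_on V \<phi>"
  shows "frechet_derivative (\<lambda>z. frechet_derivative \<phi> (at z) u) (at y) v
       = frechet_derivative (\<lambda>z. frechet_derivative \<phi> (at z) v) (at y) u"
proof -
  have inner: "((\<lambda>z. \<psi> z \<bullet> e) has_derivative (\<lambda>u. frechet_derivative \<psi> (at z) u \<bullet> e)) (at z)"
    if "smooth_on V \<psi>" "z \<in> V" for \<psi> :: "'e \<Rightarrow> 'e" and z e
    using that by (intro has_derivative_inner_left differentiable_imp_frechet smooth_on_differentiable)
  have smooth_inner: "Ck_on k V (\<lambda>z. \<psi> z \<bullet> e)" if "smooth_on V \<psi>" for k and \<psi> :: "'e \<Rightarrow> 'e" and e
    using that
  proof (induction k arbitrary: \<psi>)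
    case 0
    then show ?case
      unfolding smooth_on_def by (auto intro!: continuous_intros dest: spec[of _ "0::nat"])
  next
    case (Suc k)
    have "Ck_on k V (\<lambda>z. frechet_derivative (\<lambda>z. \<psi> z \<bullet> e) (at z) u)" for u
      by (rule Ck_on_cong[OF V(1) _ Suc.IH[OF smooth_on_frechet[OF Suc.prems, of u]]])
        (simp add: frechet_derivative_eqI[OF inner[OF Suc.prems]])
    then show ?case using inner[OF Suc.prems] by (auto simp: differentiable_def)
  qed
  have eq: "frechet_derivative (\<lambda>z. frechet_derivative \<phi> (at z) u) (at y) v \<bullet> e
      = frechet_derivative (\<lambda>z. frechet_derivative (\<lambda>z. \<phi> z \<bullet> e) (at z) u) (at y) v" for u v e
  proof -
    have "((\<lambda>z. frechet_derivative \<phi> (at z) u \<bullet> e) has_derivative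
        (\<lambda>v. frechet_derivative (\<lambda>z. frechet_derivative \<phi> (at z) u) (at y) v \<bullet> e)) (at y)"
      by (rule inner[OF smooth_on_frechet[OF \<phi>] V(2)])
    then have "((\<lambda>z. frechet_derivative (\<lambda>z. \<phi> z \<bullet> e) (at z) u) has_derivative
        (\<lambda>v. frechet_derivative (\<lambda>z. frechet_derivative \<phi> (at z) u) (at y) v \<bullet> e)) (at y)"
      by (rule has_derivative_transform_within_open[OF _ V])
        (simp add: frechet_derivative_eqI[OF inner[OF \<phi>]])
    then show ?thesis by (simp add: frechet_derivative_eqI)
  qed
  let ?d = "frechet_derivative (\<lambda>z. frechet_derivative \<phi> (at z) u) (at y) v
       - frechet_derivative (\<lambda>z. frechet_derivative \<phi> (at z) v) (at y) u"
  have "?d \<bullet> ?d = 0"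
    unfolding inner_diff_left eq
    using second_derivative_symmetric[OF V, of "\<lambda>z. \<phi> z \<bullet> ?d" u v] smooth_inner[OF \<phi>]
    by (simp add: smooth_on_def)
  then show ?thesis by simp
qed

text \<open>By the chain rule the derivative of the pullback is d of \<open>F'\<close> on the
  transported vectors plus terms with second derivatives of \<open>\<phi>\<close>, which cancel by
  symmetry. \<open>V\<close> is the overlap, possibly smaller than the chart image
  \<open>U\<close>.\<close>

lemma local_d_pullback:
  fixes \<phi> :: "'e::real_inner \<Rightarrow> 'e"
  assumes C: "finite C" "span C = (UNIV :: 'e set)" "pairwise orthogonal C"
    and F': "smooth_field U' F'" "\<And>x. altform k (F' x)"
    and V: "open V" "V \<subseteq> U" "smooth_on V \<phi>" "\<And>y. y \<in> V \<Longrightarrow> \<phi> y \<in> U'"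
    and pullback: "\<And>y vs. y \<in> V \<Longrightarrow> F y vs = F' (\<phi> y) (map (frechet_derivative \<phi> (at y)) vs)"
    and y: "y \<in> V"
  shows "local_d U F y vs = local_d U' F' (\<phi> y) (map (frechet_derivative \<phi> (at y)) vs)"
proof -
  let ?L = "\<lambda>z. frechet_derivative \<phi> (at z)"
  let ?B = "\<lambda>u w. frechet_derivative (\<lambda>z. ?L z w) (at y) u"
  have D: "frechet_derivative (\<lambda>z. F z ws) (at y) u
      = dir_deriv U' (?L y u) F' (\<phi> y) (map (?L y) ws) + slot_sum (?L y) (?B u) (F' (\<phi> y)) ws" for ws u
  proof -
    have "((\<lambda>z. F' (\<phi> z) (map (?L z) ws)) has_derivative
       (\<lambda>u. dir_deriv U' (?L y u) F' (\<phi> y) (map (?L y) ws) + slot_sum (?L y) (?B u) (F' (\<phi> y)) ws)) (at y)"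
      using V y by (intro pullback_has_derivative[OF C F'] differentiable_imp_frechet)
        (auto intro: smooth_on_differentiable smooth_on_frechet)
    then have "((\<lambda>z. F z ws) has_derivative
       (\<lambda>u. dir_deriv U' (?L y u) F' (\<phi> y) (map (?L y) ws) + slot_sum (?L y) (?B u) (F' (\<phi> y)) ws)) (at y)"
      by (rule has_derivative_transform_within_open[OF _ V(1) y]) (simp add: pullback)
    then show ?thesis by (simp add: frechet_derivative_eqI)
  qed
  have "local_d U F y vs = (\<Sum>i<length vs. (-1) ^ i * dir_deriv U' (?L y (vs ! i)) F' (\<phi> y) (map (?L y) (delete_nth i vs)))
     + (\<Sum>i<length vs. (-1) ^ i * slot_sum (?L y) (?B (vs ! i)) (F' (\<phi> y)) (delete_nth i vs))"
    using V y by (auto simp: local_d_def D distrib_left sum.distrib)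
  also have "(\<Sum>i<length vs. (-1) ^ i * slot_sum (?L y) (?B (vs ! i)) (F' (\<phi> y)) (delete_nth i vs)) = 0"
    by (rule alternating_sum_slot_sum[OF F'(2)]) (rule frechet_derivative_vector_symmetric[OF V(1) y V(3)])
  also have "(\<Sum>i<length vs. (-1) ^ i * dir_deriv U' (?L y (vs ! i)) F' (\<phi> y) (map (?L y) (delete_nth i vs)))
     = local_d U' F' (\<phi> y) (map (?L y) vs)"
    using V y by (simp add: local_d_def dir_deriv_def take_map drop_map)
  finally show ?thesis by simp
qed

section \<open>Forms on a manifold\<close>


lemma transition_apply:
  assumes "inj_on (snd c) (fst c)" "p \<in> fst c" shows "transition c c' (snd c p) = snd c' p"
  using assms by (simp add: transition_def)

lemma smooth_manifold_chart:
  assumes "smooth_manifold X A" "c \<in> A"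
  shows "open (chart_image c)" "inj_on (snd c) (fst c)"
proof -
  have c: "open (chart_image c)" "openin X (fst c)"
    "homeomorphic_map (subtopology X (fst c)) (top_of_set (chart_image c)) (snd c)"
    using assms unfolding smooth_manifold_def by auto
  show "open (chart_image c)" by (rule c)
  have "topspace (subtopology X (fst c)) = fst c"
    using c(2) openin_subset by (auto simp: topspace_subtopology)
  then show "inj_on (snd c) (fst c)"
    using homeomorphic_imp_injective_map[OF c(3)] by simp
qed

lemma smooth_manifold_overlap:
  assumes X: "smooth_manifold X A" and c: "c \<in> A" "c' \<in> A"
  shows "open (snd c ` (fst c \<inter> fst c'))" "smooth_on (snd c ` (fst c \<inter> fst c')) (transition c c')"
proof -
  show "smooth_on (snd c ` (fst c \<inter> fst c')) (transition c c')"
    using assms unfolding smooth_manifold_def by blast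
  have h: "openin X (fst c)" "openin X (fst c')" "open (chart_image c)"
    "homeomorphic_map (subtopology X (fst c)) (top_of_set (chart_image c)) (snd c)"
    using assms unfolding smooth_manifold_def by auto
  have "openin (subtopology X (fst c)) (fst c \<inter> fst c')"
    using h by (simp add: openin_open_subtopology openin_Int)
  then have "openin (top_of_set (chart_image c)) (snd c ` (fst c \<inter> fst c'))"
    using homeomorphic_imp_open_map[OF h(4)] by (simp add: open_map_def)
  then show "open (snd c ` (fst c \<inter> fst c'))"
    using h(3) openin_open_trans by blast
qed

lemma homogeneous_map_eq:
  assumes "homogeneous k f" "homogeneous k g" "\<And>vs. length vs = k \<Longrightarrow> f vs = g (map h vs)"
  shows "f vs = g (map h vs)"
  using assms by (cases "length vs = k") (simp_all add: homogeneous_def)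

text \<open>Since forms vanish off their degree, the conditions extend to lists of every length, as
  the list inductions require; overlap points are expressed in coordinates.\<close>

lemma mem_forms_iff:
  assumes X: "smooth_manifold X A"
  shows "\<omega> \<in> forms A k \<longleftrightarrow>
     (\<forall>c x. \<not> (c \<in> A \<and> x \<in> chart_image c) \<longrightarrow> \<omega> c x = 0) \<and>
     (\<forall>c x. altform k (\<omega> c x)) \<and>
     (\<forall>c\<in>A. smooth_field (chart_image c) (\<omega> c)) \<and>
     (\<forall>c\<in>A. \<forall>c'\<in>A. \<forall>y\<in>snd c ` (fst c \<inter> fst c'). \<forall>vs.
        \<omega> c y vs = \<omega> c' (transition c c' y) (map (frechet_derivative (transition c c') (at y)) vs))"
    (is "_ \<longleftrightarrow> ?R")
proof
  assume \<omega>: "\<omega> \<in> forms A k"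
  have z: "\<not> (c \<in> A \<and> x \<in> chart_image c \<and> length vs = k) \<Longrightarrow> \<omega> c x vs = 0" for c x vs
    using \<omega> unfolding forms_def by blast
  have am: "c \<in> A \<Longrightarrow> x \<in> chart_image c \<Longrightarrow> alternating_multilinear k (\<omega> c x)" for c x
    using \<omega> unfolding forms_def by blast
  have sm: "c \<in> A \<Longrightarrow> length vs = k \<Longrightarrow> smooth_on (chart_image c) (\<lambda>x. \<omega> c x vs)" for c vs
    using \<omega> unfolding forms_def by blast
  have pb: "c \<in> A \<Longrightarrow> c' \<in> A \<Longrightarrow> p \<in> fst c \<inter> fst c' \<Longrightarrow> length vs = k \<Longrightarrow> \<omega> c (snd c p) vs =
        \<omega> c' (snd c' p) (map (frechet_derivative (transition c c') (at (snd c p))) vs)" for c c' p vs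
    using \<omega> unfolding forms_def by blast
  have hom: "homogeneous k (\<omega> c x)" for c x
    using z by (simp add: homogeneous_def)
  show ?R
  proof (intro conjI allI ballI impI)
    show zero: "\<omega> c x = 0" if "\<not> (c \<in> A \<and> x \<in> chart_image c)" for c x
    proof
      show "\<omega> c x vs = 0 vs" for vs using z[of c x vs] that by auto
    qed
    show "altform k (\<omega> c x)" for c x
      using am[of c x] zero[of c x] hom[of c x] altform_zero[of k]
      by (cases "c \<in> A \<and> x \<in> chart_image c") (simp add: altform_def, simp add: altform_zero)
    show "smooth_field (chart_image c) (\<omega> c)" if "c \<in> A" for c
      unfolding smooth_field_def
    proof (intro conjI allI)
      show "smooth_on (chart_image c) (\<lambda>x. \<omega> c x vs)" for vs
      proof (cases "length vs = k")
        case True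
        then show ?thesis by (rule sm[OF that])
      next
        case False
        then have "(\<lambda>x. \<omega> c x vs) = (\<lambda>x. 0)" using z[of c _ vs] by (intro ext) simp
        then show ?thesis by (simp add: smooth_on_const)
      qed
    qed (rule smooth_manifold_chart[OF X that])
    show "\<omega> c y vs = \<omega> c' (transition c c' y) (map (frechet_derivative (transition c c') (at y)) vs)"
      if c: "c \<in> A" "c' \<in> A" and "y \<in> snd c ` (fst c \<inter> fst c')" for c c' y vs
    proof -
      obtain p where p: "p \<in> fst c \<inter> fst c'" "y = snd c p" using \<open>y \<in> _\<close> by blast
      have "transition c c' y = snd c' p"
        using p transition_apply[OF smooth_manifold_chart(2)[OF X c(1)]] by simp
      then have "\<omega> c y us = \<omega> c' (transition c c' y) (map (frechet_derivative (transition c c') (at y)) us)"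
        if "length us = k" for us
        using pb[OF c p(1) that] p(2) by simp
      then show ?thesis by (rule homogeneous_map_eq[OF hom hom])
    qed
  qed
next
  assume R: ?R
  from R have alt: "altform k (\<omega> c x)" for c x by blast
  show "\<omega> \<in> forms A k"
    unfolding forms_def mem_Collect_eq
  proof (intro conjI allI ballI impI)
    show "\<omega> c x vs = 0" if "\<not> (c \<in> A \<and> x \<in> chart_image c \<and> length vs = k)" for c x vs
      using that R[THEN conjunct1, rule_format, of c x] alt[of c x]
      by (cases "length vs = k") (auto simp: altform_def homogeneous_def)
    show "alternating_multilinear k (\<omega> c x)" for c x
      using alt[of c x] by (simp add: altform_def)
    show "smooth_on (chart_image c) (\<lambda>x. \<omega> c x vs)" if "c \<in> A" for c vs
      using R[THEN conjunct2, THEN conjunct2, THEN conjunct1] that by (simp add: smooth_field_def)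
    show "\<omega> c (snd c p) vs = \<omega> c' (snd c' p) (map (frechet_derivative (transition c c') (at (snd c p))) vs)"
      if c: "c \<in> A" "c' \<in> A" "p \<in> fst c \<inter> fst c'" for c c' p vs
    proof -
      have "\<omega> c (snd c p) vs = \<omega> c' (transition c c' (snd c p)) (map (frechet_derivative (transition c c') (at (snd c p))) vs)"
        using R[THEN conjunct2, THEN conjunct2, THEN conjunct2] c by blast
      then show ?thesis
        using c smooth_manifold_chart(2)[OF X c(1)] by (simp add: transition_apply)
    qed
  qed
qed

lemma
  assumes "smooth_manifold X A" "\<omega> \<in> forms A k"
  shows forms_outside: "\<not> (c \<in> A \<and> x \<in> chart_image c) \<Longrightarrow> \<omega> c x = 0"
    and forms_altform: "altform k (\<omega> c x)"
    and forms_smooth: "c \<in> A \<Longrightarrow> smooth_field (chart_image c) (\<omega> c)"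
    and forms_pullback: "c \<in> A \<Longrightarrow> c' \<in> A \<Longrightarrow> y \<in> snd c ` (fst c \<inter> fst c') \<Longrightarrow>
        \<omega> c y vs = \<omega> c' (transition c c' y) (map (frechet_derivative (transition c c') (at y)) vs)"
proof -
  note R = mem_forms_iff[OF assms(1), THEN iffD1, OF assms(2)]
  show "\<not> (c \<in> A \<and> x \<in> chart_image c) \<Longrightarrow> \<omega> c x = 0"
    by (rule R[THEN conjunct1, rule_format])
  show "altform k (\<omega> c x)"
    by (rule R[THEN conjunct2, THEN conjunct1, rule_format])
  show "c \<in> A \<Longrightarrow> smooth_field (chart_image c) (\<omega> c)"
    using R[THEN conjunct2, THEN conjunct2, THEN conjunct1] by simp
  show "c \<in> A \<Longrightarrow> c' \<in> A \<Longrightarrow> y \<in> snd c ` (fst c \<inter> fst c') \<Longrightarrow>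
        \<omega> c y vs = \<omega> c' (transition c c' y) (map (frechet_derivative (transition c c') (at y)) vs)"
    using R[THEN conjunct2, THEN conjunct2, THEN conjunct2] by blast
qed

lemma wedge_in_forms:
  assumes X: "smooth_manifold X A" and \<alpha>: "\<alpha> \<in> forms A p" and \<beta>: "\<beta> \<in> forms A q"
  shows "wedge \<alpha> \<beta> \<in> forms A (p + q)"
  unfolding mem_forms_iff[OF X]
proof (intro conjI allI ballI impI)
  show "wedge \<alpha> \<beta> c y vs
      = wedge \<alpha> \<beta> c' (transition c c' y) (map (frechet_derivative (transition c c') (at y)) vs)"
    if "c \<in> A" "c' \<in> A" "y \<in> snd c ` (fst c \<inter> fst c')" for c c' y vs
    by (simp add: wedge_def nths_map forms_pullback[OF X \<alpha> that] forms_pullback[OF X \<beta> that])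
  show "wedge \<alpha> \<beta> c x = 0" if "\<not> (c \<in> A \<and> x \<in> chart_image c)" for c x
    by (simp add: wedge_eq_shuffle forms_outside[OF X \<alpha> that])
  show "altform (p + q) (wedge \<alpha> \<beta> c x)" for c x
    by (simp add: wedge_eq_shuffle altform_shuffle forms_altform[OF X \<alpha>] forms_altform[OF X \<beta>])
  show "smooth_field (chart_image c) (wedge \<alpha> \<beta> c)" if "c \<in> A" for c
    using smooth_field_shuffle[OF forms_smooth[OF X \<alpha> that] forms_smooth[OF X \<beta> that]]
    by (simp flip: wedge_eq_shuffle)
qed

lemma exists_orthogonal_spanning_set:
  fixes A :: "('a, 'e::real_inner) chart set"
  assumes "smooth_manifold X A"
  obtains C :: "'e set" where "finite C" "span C = UNIV" "pairwise orthogonal C"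
proof -
  obtain B :: "'e set" where "finite B" "span B = UNIV"
    using assms unfolding smooth_manifold_def by blast
  then show thesis using basis_orthogonal[of B] that by metis
qed

lemma ext_d_in_forms:
  fixes A :: "('a, 'e::real_inner) chart set"
  assumes X: "smooth_manifold X A" and "\<omega> \<in> forms A k"
  shows "ext_d \<omega> \<in> forms A (Suc k)"
proof -
  obtain C :: "'e set" where C: "finite C" "span C = UNIV" "pairwise orthogonal C"
    using exists_orthogonal_spanning_set[OF X] .
  note zero = forms_outside[OF X assms(2)] and alt = forms_altform[OF X assms(2)]
    and smooth = forms_smooth[OF X assms(2)]
  \<comment> \<open>\<open>ext_d\<close> tests only the chart image, so for a pair outside the atlas
    the vanishing comes from that of \<open>\<omega>\<close>.\<close>
  have d_zero: "ext_d \<omega> c x = 0" if "\<not> (c \<in> A \<and> x \<in> chart_image c)" for c x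
  proof (cases "x \<in> chart_image c")
    case True
    then have "\<omega> c = (\<lambda>x. 0)" using that zero[of c] by (intro ext) simp
    then show ?thesis by (simp add: ext_d_eq_local_d local_d_zero)
  qed (simp add: ext_d_eq_local_d local_d_outside)
  show ?thesis
    unfolding mem_forms_iff[OF X]
  proof (intro conjI allI ballI impI)
    show "altform (Suc k) (ext_d \<omega> c x)" for c x
      using altform_local_d[OF smooth alt, of c x] d_zero[of c x] altform_zero
      by (cases "c \<in> A") (auto simp: ext_d_eq_local_d)
    show "smooth_field (chart_image c) (ext_d \<omega> c)" if "c \<in> A" for c
      by (simp add: ext_d_eq_local_d smooth_field_local_d smooth that)
    fix c c' y vs assume c: "c \<in> A" "c' \<in> A" and y: "y \<in> snd c ` (fst c \<inter> fst c')"
    have "transition c c' z \<in> chart_image c'" if "z \<in> snd c ` (fst c \<inter> fst c')" for z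
    proof -
      obtain p where "z = snd c p" "p \<in> fst c" "p \<in> fst c'" using \<open>z \<in> _\<close> by blast
      then show ?thesis
        using transition_apply[OF smooth_manifold_chart(2)[OF X c(1)], of p c'] by (simp add: chart_image_def)
    qed
    moreover have "snd c ` (fst c \<inter> fst c') \<subseteq> chart_image c"
      by (auto simp: chart_image_def)
    moreover note forms_pullback[OF X assms(2) c]
    ultimately show "ext_d \<omega> c y vs
        = ext_d \<omega> c' (transition c c' y) (map (frechet_derivative (transition c c') (at y)) vs)"
      unfolding ext_d_eq_local_d
      by (intro local_d_pullback[OF C smooth[OF c(2)] alt smooth_manifold_overlap(1)[OF X c] _
        smooth_manifold_overlap(2)[OF X c] _ _ y]) simp_all
  qed (use d_zero in simp)
qed

lemma forms_above_dim:
  fixes A :: "('a, 'e::real_inner) chart set" and B :: "'e set"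
  assumes X: "smooth_manifold X A" and B: "finite B" "span B = UNIV"
    and \<omega>: "\<omega> \<in> forms A k" "card B < k"
  shows "\<omega> = 0"
  using altform_above_dim[OF B(2,1) \<omega>(2) forms_altform[OF X \<omega>(1)]] by (simp add: fun_eq_iff)

lemma ext_d_ext_d:
  assumes X: "smooth_manifold X A" and \<omega>: "\<omega> \<in> forms A k"
  shows "ext_d (ext_d \<omega>) = 0"
proof (intro ext)
  fix c x vs
  have "ext_d (ext_d \<omega>) c x = 0"
  proof (cases "c \<in> A")
    case True
    then show ?thesis by (simp add: ext_d_eq_local_d local_d_local_d forms_smooth[OF X \<omega>])
  next
    case False
    then show ?thesis
      using forms_outside[OF X ext_d_in_forms[OF X ext_d_in_forms[OF X \<omega>]], of c x] by simp
  qed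
  then show "ext_d (ext_d \<omega>) c x vs = 0 c x vs" by simp
qed

lemma ext_d_wedge_closed_odd:
  assumes X: "smooth_manifold X A" and \<alpha>: "\<alpha> \<in> forms A p" "odd p" "ext_d \<alpha> = 0" and \<omega>: "\<omega> \<in> forms A k"
  shows "ext_d (wedge \<alpha> \<omega>) = - wedge \<alpha> (ext_d \<omega>)"
proof (intro ext)
  fix c x vs
  have "ext_d (wedge \<alpha> \<omega>) c x = - wedge \<alpha> (ext_d \<omega>) c x"
  proof (cases "c \<in> A")
    case True
    then have s: "smooth_field (chart_image c) (\<alpha> c)" "smooth_field (chart_image c) (\<omega> c)"
      by (rule forms_smooth[OF X \<alpha>(1)], rule forms_smooth[OF X \<omega>])
    have i: "involute (\<alpha> c x) = - \<alpha> c x"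
      using forms_altform[OF X \<alpha>(1)] \<alpha>(2) involute_homogeneous[of p "\<alpha> c x"] by (simp add: altform_def fun_Compl_def)
    have "local_d (chart_image c) (\<alpha> c) x = 0"
      using \<alpha>(3) by (simp flip: ext_d_eq_local_d)
    then have "local_d (chart_image c) (\<lambda>x. shuffle (\<alpha> c x) (\<omega> c x)) x
        = - shuffle (\<alpha> c x) (local_d (chart_image c) (\<omega> c) x)"
      using local_d_shuffle[OF s] i by (simp add: shuffle_minus_left)
    moreover have "wedge \<alpha> \<omega> c = (\<lambda>x. shuffle (\<alpha> c x) (\<omega> c x))"
      by (simp add: wedge_eq_shuffle fun_eq_iff)
    ultimately show ?thesis by (simp add: ext_d_eq_local_d wedge_eq_shuffle)
  next
    case False
    then show ?thesis
      using forms_outside[OF X wedge_in_forms[OF X \<alpha>(1) ext_d_in_forms[OF X \<omega>]], of c x]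
        forms_outside[OF X ext_d_in_forms[OF X wedge_in_forms[OF X \<alpha>(1) \<omega>]], of c x] by simp
  qed
  then show "ext_d (wedge \<alpha> \<omega>) c x vs = (- wedge \<alpha> (ext_d \<omega>)) c x vs" by simp
qed

lemma wedge_anticommute:
  assumes X: "smooth_manifold X A" and "\<alpha> \<in> forms A p" "odd p" "\<beta> \<in> forms A q" "odd q"
  shows "wedge \<alpha> (wedge \<beta> \<omega>) = - wedge \<beta> (wedge \<alpha> \<omega>)"
proof (intro ext)
  fix c x vs
  have "homogeneous p (\<alpha> c x)" "homogeneous q (\<beta> c x)"
    using forms_altform[OF X assms(2), of c x] forms_altform[OF X assms(4), of c x]
    by (simp_all add: altform_def)
  then have "shuffle (\<alpha> c x) (\<beta> c x) = - shuffle (\<beta> c x) (\<alpha> c x)"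
    using shuffle_graded_commute[of p "\<alpha> c x" q "\<beta> c x"] assms(3,5) by (intro ext) simp
  then show "wedge \<alpha> (wedge \<beta> \<omega>) c x vs = (- wedge \<beta> (wedge \<alpha> \<omega>)) c x vs"
    by (simp add: wedge_eq_shuffle shuffle_minus_left flip: shuffle_assoc)
qed

section \<open>Operators on forms with coefficients\<close>


text \<open>The domain \<open>M\<close> is a subspace containing forms of all degrees: finite sums
  mix degrees, and the forms of the separate degrees do not together form a subspace.\<close>

definition linear_operator_on ::
  "('a, 'e, real) form set \<Rightarrow> (('a, 'e, real) form \<Rightarrow> ('a, 'e, real) form) \<Rightarrow> bool" where
  "linear_operator_on M S \<longleftrightarrow> 0 \<in> M \<and>
     (\<forall>\<omega>\<in>M. \<forall>\<omega>'\<in>M. \<omega> + \<omega>' \<in> M \<and> S (\<omega> + \<omega>') = S \<omega> + S \<omega>') \<and>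
     (\<forall>a. \<forall>\<omega>\<in>M. (\<lambda>c x vs. a * \<omega> c x vs) \<in> M \<and> S (\<lambda>c x vs. a * \<omega> c x vs) = (\<lambda>c x vs. a * S \<omega> c x vs))"

lemma linear_operator_on_wedge: "linear_operator_on UNIV (wedge \<alpha>)"
  by (simp add: linear_operator_on_def fun_eq_iff wedge_eq_shuffle shuffle_add_right shuffle_scale_right)

text \<open>Smoothness in charts is what additivity of \<open>ext_d\<close> requires, and it
  survives sums of different degrees.\<close>

definition smooth_on_charts :: "('a, 'e::real_inner) chart set \<Rightarrow> ('a, 'e, real) form set" where
  "smooth_on_charts A = {\<omega>. (\<forall>c\<in>A. smooth_field (chart_image c) (\<omega> c)) \<and> (\<forall>c. c \<notin> A \<longrightarrow> \<omega> c = 0)}"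

lemma forms_subset_smooth_on_charts:
  "smooth_manifold X A \<Longrightarrow> forms A k \<subseteq> smooth_on_charts A"
  using forms_smooth[of X A _ k] forms_outside[of X A _ k]
  by (auto simp: smooth_on_charts_def intro!: ext simp del: split_paired_All)

lemma linear_operator_on_ext_d:
  assumes X: "smooth_manifold X A" shows "linear_operator_on (smooth_on_charts A) ext_d"
  unfolding linear_operator_on_def
proof (intro conjI ballI allI)
  let ?M = "smooth_on_charts A"
  show "0 \<in> ?M"
    using smooth_manifold_chart(1)[OF X]
    by (simp add: smooth_on_charts_def smooth_field_def smooth_on_const)
  fix \<omega> assume \<omega>: "\<omega> \<in> ?M"
  have s: "smooth_field (chart_image c) (\<omega> c)" if "c \<in> A" for c
    using \<omega> that by (simp add: smooth_on_charts_def)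
  have z: "\<omega> c = 0" if "c \<notin> A" for c
    using \<omega> that unfolding smooth_on_charts_def by blast
  {
    fix \<omega>' assume \<omega>': "\<omega>' \<in> ?M"
    have s': "smooth_field (chart_image c) (\<omega>' c)" if "c \<in> A" for c
      using \<omega>' that by (simp add: smooth_on_charts_def)
    have z': "\<omega>' c = 0" if "c \<notin> A" for c
      using \<omega>' that unfolding smooth_on_charts_def by blast
    have pt: "(\<omega> + \<omega>') c = (\<lambda>x. \<omega> c x + \<omega>' c x)" for c
      by (simp add: fun_eq_iff)
    show "\<omega> + \<omega>' \<in> ?M"
      unfolding smooth_on_charts_def mem_Collect_eq pt
    proof (intro conjI ballI allI impI)
      show "smooth_field (chart_image c) (\<lambda>x. \<omega> c x + \<omega>' c x)" if "c \<in> A" for c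
        by (rule smooth_field_add[OF s[OF that] s'[OF that]])
      show "(\<lambda>x. \<omega> c x + \<omega>' c x) = 0" if "c \<notin> A" for c
        by (simp add: z[OF that] z'[OF that] fun_eq_iff)
    qed
    have "ext_d (\<omega> + \<omega>') c = ext_d \<omega> c + ext_d \<omega>' c" for c
      using local_d_add[OF s s', of c] z[of c] z'[of c]
      by (cases "c \<in> A") (simp_all add: ext_d_eq_local_d pt zero_fun_def plus_fun_def local_d_zero[unfolded zero_fun_def])
    then show "ext_d (\<omega> + \<omega>') = ext_d \<omega> + ext_d \<omega>'"
      by (simp add: fun_eq_iff)
  }
  fix a
  show "(\<lambda>c x vs. a * \<omega> c x vs) \<in> ?M"
    unfolding smooth_on_charts_def mem_Collect_eq
  proof (intro conjI ballI allI impI)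
    show "smooth_field (chart_image c) (\<lambda>x vs. a * \<omega> c x vs)" if "c \<in> A" for c
      by (rule smooth_field_scale[OF s[OF that]])
    show "(\<lambda>x vs. a * \<omega> c x vs) = 0" if "c \<notin> A" for c
      by (simp add: z[OF that] fun_eq_iff)
  qed
  have "ext_d (\<lambda>c x vs. a * \<omega> c x vs) c = (\<lambda>x vs. a * ext_d \<omega> c x vs)" for c
    using local_d_scale[OF s, of c a] z[of c] 
    by (cases "c \<in> A") (simp_all add: ext_d_eq_local_d zero_fun_def local_d_zero[unfolded zero_fun_def])
  then show "ext_d (\<lambda>c x vs. a * \<omega> c x vs) = (\<lambda>c x vs. a * ext_d \<omega> c x vs)"
    by (simp add: fun_eq_iff)
qed

text \<open>Algebraic functionals suffice, so the coefficient ring may be infinite-dimensional and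
  carries no topology.\<close>

lemma eq_if_linear_functionals_eq:
  fixes a b :: "'r::real_vector"
  assumes "\<And>\<phi> :: 'r \<Rightarrow> real. linear \<phi> \<Longrightarrow> \<phi> a = \<phi> b"
  shows "a = b"
proof (rule ccontr)
  assume "a \<noteq> b"
  then have "independent {a - b}" by (simp add: dependent_single)
  then obtain \<phi> :: "'r \<Rightarrow> real" where "linear \<phi>" "\<phi> (a - b) = 1"
    using linear_independent_extend[of "{a - b}" "\<lambda>_. 1"] by auto
  then show False using assms[of \<phi>] by (simp add: linear_diff)
qed

section \<open>Independence of the representation as a finite sum\<close>

lemma tensor_sum_Nil [simp]: "tensor_sum [] = 0"
  by (simp add: tensor_sum_def)

lemma tensor_sum_Cons [simp]: "tensor_sum ((\<omega>, r) # ts) = tensor \<omega> r + tensor_sum ts"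
  by (simp add: tensor_sum_def)

lemma tensor_sum_append [simp]: "tensor_sum (ts @ ts') = tensor_sum ts + tensor_sum ts'"
  by (simp add: tensor_sum_def)

text \<open>Applying a linear functional to the coefficients reduces operators on forms with coefficients
  to operators on ordinary forms.\<close>

lemma functional_tensor_sum_map:
  assumes S: "linear_operator_on M S" and T: "linear T" and \<phi>: "linear (\<phi> :: 'r \<Rightarrow> real)"
    and ts: "\<forall>(\<omega>, r)\<in>set ts. \<omega> \<in> M"
  shows "(\<lambda>c x vs. \<phi> (T (tensor_sum ts c x vs))) \<in> M
    \<and> (\<lambda>c x vs. \<phi> (tensor_sum (map (\<lambda>(\<omega>, r). (S \<omega>, T r)) ts) c x vs))
      = S (\<lambda>c x vs. \<phi> (T (tensor_sum ts c x vs :: 'r::real_algebra_1)))"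
  using ts
proof (induction ts)
  case Nil
  \<comment> \<open>\<open>S 0 = 0\<close> is obtained from homogeneity with the scalar 0.\<close>
  have "0 \<in> M" "S (\<lambda>c x vs. 0 * 0 c x vs) = (\<lambda>c x vs. 0 * S 0 c x vs)"
    using S unfolding linear_operator_on_def by blast+
  then show ?case
    by (simp add: linear_0[OF T] linear_0[OF \<phi>] zero_fun_def)
next
  case (Cons t ts)
  obtain \<omega> r where t: "t = (\<omega>, r)" by (cases t)
  let ?h = "\<lambda>c x vs. \<phi> (T (tensor_sum ts c x vs))" and ?k = "\<lambda>c x vs. \<phi> (T r) * \<omega> c x vs"
  have M: "\<omega> \<in> M" "?h \<in> M" using Cons t by auto
  have k: "?k \<in> M" "S ?k = (\<lambda>c x vs. \<phi> (T r) * S \<omega> c x vs)"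
    using S M(1) unfolding linear_operator_on_def by blast+
  have kh: "?k + ?h \<in> M" "S (?k + ?h) = S ?k + S ?h"
    using S M(2) k(1) unfolding linear_operator_on_def by blast+
  have "(\<lambda>c x vs. \<phi> (T (tensor_sum (t # ts) c x vs))) = ?k + ?h"
    by (simp add: t tensor_def fun_eq_iff linear_add[OF T] linear_cmul[OF T] linear_add[OF \<phi>] linear_cmul[OF \<phi>])
  moreover have "(\<lambda>c x vs. \<phi> (tensor_sum (map (\<lambda>(\<omega>, r). (S \<omega>, T r)) (t # ts)) c x vs))
      = S ?k + (\<lambda>c x vs. \<phi> (tensor_sum (map (\<lambda>(\<omega>, r). (S \<omega>, T r)) ts) c x vs))"
    by (simp add: t tensor_def fun_eq_iff linear_add[OF \<phi>] linear_cmul[OF \<phi>] k)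
  ultimately show ?case
    using Cons kh by (simp add: plus_fun_def)
qed

text \<open>Justifies the description in \<open>tensor_map\<close>. After any linear functional the
  result is \<open>S\<close> of a real form built from the sum itself, not from its summands, so two
  representations give the same value.\<close>

lemma tensor_map_tensor_sum:
  fixes T :: "'r::real_algebra_1 \<Rightarrow> 'r"
  assumes S: "linear_operator_on M S" and M: "\<And>k. forms A k \<subseteq> M" and T: "linear T"
    and ts: "\<forall>(\<omega>, r)\<in>set ts. \<exists>p. \<omega> \<in> forms A p"
  shows "tensor_map A S T (tensor_sum ts) = tensor_sum (map (\<lambda>(\<omega>, r). (S \<omega>, T r)) ts)"
  unfolding tensor_map_def
proof (rule the_equality)
  show "\<exists>ts'. (\<forall>(\<omega>, r)\<in>set ts'. \<exists>p. \<omega> \<in> forms A p) \<and> tensor_sum ts = tensor_sum ts' \<and>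
      tensor_sum (map (\<lambda>(\<omega>, r). (S \<omega>, T r)) ts) = tensor_sum (map (\<lambda>(\<omega>, r). (S \<omega>, T r)) ts')"
    using ts by blast
next
  fix \<zeta> assume "\<exists>ts'. (\<forall>(\<omega>, r)\<in>set ts'. \<exists>p. \<omega> \<in> forms A p) \<and> tensor_sum ts = tensor_sum ts' \<and>
      \<zeta> = tensor_sum (map (\<lambda>(\<omega>, r). (S \<omega>, T r)) ts')"
  then obtain ts' where ts': "\<forall>(\<omega>, r)\<in>set ts'. \<exists>p. \<omega> \<in> forms A p" "tensor_sum ts = tensor_sum ts'"
      "\<zeta> = tensor_sum (map (\<lambda>(\<omega>, r). (S \<omega>, T r)) ts')"
    by blast
  have inM: "\<forall>(\<omega>, r)\<in>set ts. \<omega> \<in> M" "\<forall>(\<omega>, r)\<in>set ts'. \<omega> \<in> M"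
    using ts ts'(1) M by blast+
  show "\<zeta> = tensor_sum (map (\<lambda>(\<omega>, r). (S \<omega>, T r)) ts)"
  proof (intro ext, rule eq_if_linear_functionals_eq)
    fix c x vs and \<phi> :: "'r \<Rightarrow> real" assume \<phi>: "linear \<phi>"
    have e: "(\<lambda>c x vs. \<phi> (tensor_sum (map (\<lambda>(\<omega>, r). (S \<omega>, T r)) us) c x vs))
        = S (\<lambda>c x vs. \<phi> (T (tensor_sum us c x vs)))" if "\<forall>(\<omega>, r)\<in>set us. \<omega> \<in> M" for us
      by (rule functional_tensor_sum_map[THEN conjunct2, OF S T \<phi> that])
    have "(\<lambda>c x vs. \<phi> (\<zeta> c x vs)) = S (\<lambda>c x vs. \<phi> (T (tensor_sum ts' c x vs)))"
      unfolding ts'(3) by (rule e[OF inM(2)])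
    also have "\<dots> = (\<lambda>c x vs. \<phi> (tensor_sum (map (\<lambda>(\<omega>, r). (S \<omega>, T r)) ts) c x vs))"
      unfolding ts'(2)[symmetric] by (rule e[OF inM(1), symmetric])
    finally have eq: "(\<lambda>c x vs. \<phi> (\<zeta> c x vs))
        = (\<lambda>c x vs. \<phi> (tensor_sum (map (\<lambda>(\<omega>, r). (S \<omega>, T r)) ts) c x vs))" .
    show "\<phi> (\<zeta> c x vs) = \<phi> (tensor_sum (map (\<lambda>(\<omega>, r). (S \<omega>, T r)) ts) c x vs)"
      by (rule fun_cong[OF fun_cong[OF fun_cong[OF eq, of c], of x], of vs])
  qed
qed

text \<open>Multiplying the homogeneous parts of \<open>w\<close> by \<open>v\<close> decomposes 1.
  By uniqueness only the degree 0 part survives, and left multiplication by \<open>v\<close> is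
  injective, so \<open>w\<close> has only a part of degree \<open>- n\<close>.\<close>

lemma inverse_homogeneous:
  assumes G: "graded_commutative G" and v: "v \<in> G n" and inv: "v * w = 1" "w * v = 1"
  shows "w \<in> G (- n)"
proof -
  have zero: "0 \<in> G k" for k
    using G unfolding graded_commutative_def by (meson subspace_0)
  have mult: "a * b \<in> G (j + k)" if "a \<in> G j" "b \<in> G k" for a b j k
    using G that unfolding graded_commutative_def by blast
  have one: "1 \<in> G 0"
    using G unfolding graded_commutative_def by blast
  have decomp: "\<exists>!f. (\<forall>k. f k \<in> G k) \<and> finite {k. f k \<noteq> 0} \<and> r = (\<Sum>k | f k \<noteq> 0. f k)" for r
    using G unfolding graded_commutative_def by blast
  obtain f where f: "\<And>k. f k \<in> G k" "finite {k. f k \<noteq> 0}" "w = (\<Sum>k | f k \<noteq> 0. f k)"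
    using decomp[of w] by blast
  \<comment> \<open>The shift by \<open>n\<close> places the product \<open>v * f (m - n)\<close> in
    degree \<open>m\<close>.\<close>
  define g where "g = (\<lambda>m. v * f (m - n))"
  have nz: "v * a \<noteq> 0" if "a \<noteq> 0" for a
    using that inv(2) by (metis mult.assoc mult_1 mult_zero_right)
  have supp: "{m. g m \<noteq> 0} = (\<lambda>k. k + n) ` {k. f k \<noteq> 0}"
  proof (intro set_eqI iffI)
    fix m assume "m \<in> {m. g m \<noteq> 0}"
    then have "f (m - n) \<noteq> 0" by (auto simp: g_def)
    then show "m \<in> (\<lambda>k. k + n) ` {k. f k \<noteq> 0}" by (auto intro: image_eqI[of _ _ "m - n"])
  qed (auto simp: g_def nz)
  have "(\<Sum>m | g m \<noteq> 0. g m) = (\<Sum>k | f k \<noteq> 0. v * f k)"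
    unfolding supp by (subst sum.reindex) (auto simp: inj_on_def g_def)
  also have "\<dots> = 1"
    using f(3) inv(1) by (simp add: sum_distrib_left)
  finally have g1: "(\<forall>k. g k \<in> G k) \<and> finite {k. g k \<noteq> 0} \<and> 1 = (\<Sum>k | g k \<noteq> 0. g k)"
    using mult[OF v f(1), of "_ - n"] f(2) by (simp add: supp) (simp add: g_def)
  have d1: "(\<forall>k. (if k = 0 then 1 else 0) \<in> G k) \<and> finite {k. (if k = (0::int) then 1 else 0) \<noteq> (0::'a)}
      \<and> 1 = (\<Sum>k | (if k = (0::int) then 1 else 0) \<noteq> (0::'a). if k = 0 then 1 else 0)"
    using zero one by simp
  obtain h where h: "\<And>f. (\<forall>k. f k \<in> G k) \<and> finite {k. f k \<noteq> 0} \<and> 1 = (\<Sum>k | f k \<noteq> 0. f k) \<Longrightarrow> f = h"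
    using decomp[of 1] by (elim ex1E) blast
  have g: "g = (\<lambda>k. if k = 0 then 1 else 0)"
    unfolding h[OF g1] by (rule h[OF d1, symmetric])
  have "f k = 0" if "k \<noteq> - n" for k
    using nz[of "f k"] fun_cong[OF g, of "k + n"] that by (auto simp: g_def)
  then have "w = (\<Sum>k\<in>{- n}. f k)"
    unfolding f(3) by (intro sum.mono_neutral_left) blast+
  then show ?thesis using f(1) by simp
qed

section \<open>The twisted differential\<close>


text \<open>Treats all forms with coefficients and those of one total degree alike, so closure and
  induction are proved once.\<close>

definition tensor_span ::
  "(('a, 'e, real) form \<Rightarrow> 'r::real_algebra_1 \<Rightarrow> bool) \<Rightarrow> ('a, 'e, 'r) form set" where
  "tensor_span P = {tensor_sum ts |ts. \<forall>(\<omega>, r)\<in>set ts. P \<omega> r}"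

lemma forms_tensor_eq: "forms_tensor A = tensor_span (\<lambda>\<omega> r. \<exists>p. \<omega> \<in> forms A p)"
  by (simp add: forms_tensor_def tensor_span_def)

lemma forms_tensor_deg_eq:
  "forms_tensor_deg A G m = tensor_span (\<lambda>\<omega> r. \<exists>p q. \<omega> \<in> forms A p \<and> r \<in> G q \<and> int p + q = m)"
  by (simp add: forms_tensor_deg_def tensor_span_def)

lemma tensor_span_zero: "0 \<in> tensor_span P"
  unfolding tensor_span_def by (auto intro!: exI[of _ "[]"])

lemma tensor_in_tensor_span: "P \<omega> r \<Longrightarrow> tensor \<omega> r \<in> tensor_span P"
  unfolding tensor_span_def by (auto intro!: exI[of _ "[(\<omega>, r)]"])

lemma tensor_span_add:
  assumes "\<eta> \<in> tensor_span P" "\<xi> \<in> tensor_span P" shows "\<eta> + \<xi> \<in> tensor_span P"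
proof -
  obtain ts us where "\<eta> = tensor_sum ts" "\<forall>(\<omega>, r)\<in>set ts. P \<omega> r"
      "\<xi> = tensor_sum us" "\<forall>(\<omega>, r)\<in>set us. P \<omega> r"
    using assms unfolding tensor_span_def by blast
  then have "\<eta> + \<xi> = tensor_sum (ts @ us)" "\<forall>(\<omega>, r)\<in>set (ts @ us). P \<omega> r" by auto
  then show ?thesis unfolding tensor_span_def by blast
qed

lemma tensor_span_sum:
  "(\<And>i. i \<in> I \<Longrightarrow> \<eta> i \<in> tensor_span P) \<Longrightarrow> (\<Sum>i\<in>I. \<eta> i) \<in> tensor_span P"
  by (induction I rule: infinite_finite_induct) (auto simp: tensor_span_zero intro: tensor_span_add)

lemma tensor_span_induct [consumes 1, case_names zero add]:
  assumes "\<eta> \<in> tensor_span P" and zero: "Q 0"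
    and add: "\<And>\<omega> r \<xi>. P \<omega> r \<Longrightarrow> \<xi> \<in> tensor_span P \<Longrightarrow> Q \<xi> \<Longrightarrow> Q (tensor \<omega> r + \<xi>)"
  shows "Q \<eta>"
proof -
  obtain ts where ts: "\<forall>(\<omega>, r)\<in>set ts. P \<omega> r" and \<eta>: "\<eta> = tensor_sum ts"
    using assms(1) unfolding tensor_span_def by blast
  have "Q (tensor_sum ts)"
    using ts
  proof (induction ts)
    case (Cons t ts)
    obtain \<omega> r where t: "t = (\<omega>, r)" by (cases t)
    have "tensor_sum ts \<in> tensor_span P"
      using Cons.prems unfolding tensor_span_def by auto
    then have "Q (tensor \<omega> r + tensor_sum ts)"
      using Cons t by (intro add) auto
    then show ?case by (simp only: t tensor_sum_Cons)
  qed (simp only: tensor_sum_Nil zero)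
  then show ?thesis by (simp only: \<eta>)
qed

lemma tensor_span_mono: "(\<And>\<omega> r. P \<omega> r \<Longrightarrow> Q \<omega> r) \<Longrightarrow> \<eta> \<in> tensor_span P \<Longrightarrow> \<eta> \<in> tensor_span Q"
  unfolding tensor_span_def by blast

lemma tensor_minus_left: "tensor (- \<omega>) r = - tensor \<omega> r"
  by (simp add: tensor_def fun_eq_iff)

lemma tensor_zero_left: "tensor 0 r = 0"
  by (simp add: tensor_def fun_eq_iff)

lemma tensor_scale_right: "tensor \<omega> (a *\<^sub>R r) = (\<lambda>c x vs. a *\<^sub>R tensor \<omega> r c x vs)"
  by (simp add: tensor_def fun_eq_iff)

lemma finite_nonzero_forms:
  assumes X: "smooth_manifold X A" and H: "\<And>i. i \<ge> 1 \<Longrightarrow> H i \<in> forms A (2 * i + 1)"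
  shows "finite {i. 1 \<le> i \<and> H i \<noteq> 0}"
proof -
  obtain B :: "'b set" where B: "finite B" "span B = UNIV"
    using X unfolding smooth_manifold_def by blast
  have "i \<le> card B" if "1 \<le> i" "H i \<noteq> 0" for i
  proof -
    have "\<not> card B < 2 * i + 1"
    proof
      assume "card B < 2 * i + 1"
      then have "H i = 0" by (rule forms_above_dim[OF X B H[OF that(1)]])
      then show False using that(2) by contradiction
    qed
    then show ?thesis by simp
  qed
  then have "{i. 1 \<le> i \<and> H i \<noteq> 0} \<subseteq> {..card B}" by blast
  then show ?thesis by (rule finite_subset) simp
qed

lemma sum_fun_apply: "(\<Sum>i\<in>I. f i) x = (\<Sum>i\<in>I. f i x)"
  by (induction I rule: infinite_finite_induct) simp_all

text \<open>Exchanging the summations shows that the sum equals its negative; real scalars allow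
  division by 2. Diagonal terms are included.\<close>

lemma sum_antisymmetric_eq_0:
  fixes a :: "nat \<Rightarrow> nat \<Rightarrow> 'b::real_vector"
  assumes "\<And>i j. i \<in> I \<Longrightarrow> j \<in> I \<Longrightarrow> a i j = - a j i"
  shows "(\<Sum>i\<in>I. \<Sum>j\<in>I. a i j) = 0"
proof -
  have "(\<Sum>i\<in>I. \<Sum>j\<in>I. a i j) = (\<Sum>i\<in>I. \<Sum>j\<in>I. - a j i)"
    by (intro sum.cong refl assms)
  also have "\<dots> = - (\<Sum>i\<in>I. \<Sum>j\<in>I. a i j)"
    by (subst sum.swap) (simp add: sum_negf)
  finally have "2 *\<^sub>R (\<Sum>i\<in>I. \<Sum>j\<in>I. a i j) = 0"
    unfolding scaleR_2 by (simp only: eq_neg_iff_add_eq_0)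
  then show ?thesis by simp
qed

section \<open>The twisted differential on sums of simple tensors\<close>

context
  fixes X :: "'a topology" and A :: "('a, 'e::real_inner) chart set"
    and H :: "nat \<Rightarrow> ('a, 'e, real) form" and w :: "nat \<Rightarrow> 'r::real_algebra_1"
  assumes X: "smooth_manifold X A"
    and H: "\<And>i. i \<ge> 1 \<Longrightarrow> H i \<in> forms A (2 * i + 1)"
begin

abbreviation "indices \<equiv> {i. 1 \<le> i \<and> H i \<noteq> 0}"

definition simple_d :: "('a, 'e, real) form \<Rightarrow> 'r \<Rightarrow> ('a, 'e, 'r) form" where
  "simple_d \<omega> r = tensor (ext_d \<omega>) r + (\<Sum>i\<in>indices. tensor (wedge (H i) \<omega>) (w i * r))"

text \<open>Eliminates the descriptions behind \<open>twisted_d\<close>: independence of the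
  representation holds on \<open>smooth_on_charts A\<close> for d and on all functions for the wedge
  products.\<close>

lemma twisted_d_tensor_sum:
  assumes "\<forall>(\<omega>, r)\<in>set ts. \<exists>p. \<omega> \<in> forms A p"
  shows "twisted_d A H w (tensor_sum ts) = (\<Sum>(\<omega>, r)\<leftarrow>ts. simple_d \<omega> r)"
proof -
  have d: "tensor_map A ext_d id (tensor_sum ts) = tensor_sum (map (\<lambda>(\<omega>, r). (ext_d \<omega>, id r)) ts)"
    by (rule tensor_map_tensor_sum[OF linear_operator_on_ext_d[OF X] forms_subset_smooth_on_charts[OF X] linear_id assms])
  have "linear ((*) (w i))" for i
    by (simp add: linearI distrib_left)
  then have W: "tensor_map A (wedge (H i)) ((*) (w i)) (tensor_sum ts)
      = tensor_sum (map (\<lambda>(\<omega>, r). (wedge (H i) \<omega>, w i * r)) ts)" for i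
    by (rule tensor_map_tensor_sum[OF linear_operator_on_wedge subset_UNIV _ assms])
  have "tensor_sum (map (\<lambda>(\<omega>, r). (ext_d \<omega>, id r)) ts)
      + (\<Sum>i\<in>indices. tensor_sum (map (\<lambda>(\<omega>, r). (wedge (H i) \<omega>, w i * r)) ts))
      = (\<Sum>(\<omega>, r)\<leftarrow>ts. simple_d \<omega> r)"
  proof (induction ts)
    case (Cons t ts)
    then show ?case
      by (cases t) (simp add: simple_d_def sum.distrib add_ac del: plus_fun_apply zero_fun_apply)
  qed simp
  then show ?thesis by (simp only: twisted_d_def d W)
qed

lemma twisted_d_add:
  assumes "\<eta> \<in> forms_tensor A" "\<xi> \<in> forms_tensor A"
  shows "twisted_d A H w (\<eta> + \<xi>) = twisted_d A H w \<eta> + twisted_d A H w \<xi>"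
proof -
  obtain ts us where ts: "\<eta> = tensor_sum ts" "\<forall>(\<omega>, r)\<in>set ts. \<exists>p. \<omega> \<in> forms A p"
      and us: "\<xi> = tensor_sum us" "\<forall>(\<omega>, r)\<in>set us. \<exists>p. \<omega> \<in> forms A p"
    using assms unfolding forms_tensor_def by blast
  have "\<eta> + \<xi> = tensor_sum (ts @ us)" "\<forall>(\<omega>, r)\<in>set (ts @ us). \<exists>p. \<omega> \<in> forms A p"
    using ts us by auto
  then show ?thesis
    using twisted_d_tensor_sum[of "ts @ us"] twisted_d_tensor_sum[OF ts(2)] twisted_d_tensor_sum[OF us(2)]
    by (simp add: ts(1) us(1))
qed

lemma twisted_d_zero: "twisted_d A H w 0 = 0"
  using twisted_d_tensor_sum[of "[]"] by simp

lemma twisted_d_tensor: "\<omega> \<in> forms A p \<Longrightarrow> twisted_d A H w (tensor \<omega> r) = simple_d \<omega> r"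
  using twisted_d_tensor_sum[of "[(\<omega>, r)]"] by auto

lemma twisted_d_sum:
  "(\<And>i. i \<in> I \<Longrightarrow> \<eta> i \<in> forms_tensor A) \<Longrightarrow>
    twisted_d A H w (\<Sum>i\<in>I. \<eta> i) = (\<Sum>i\<in>I. twisted_d A H w (\<eta> i))"
proof (induction I rule: infinite_finite_induct)
  case (insert i I)
  then show ?case
    using twisted_d_add[of "\<eta> i" "sum \<eta> I"] tensor_span_sum[of I \<eta>]
    by (simp add: forms_tensor_eq del: plus_fun_apply)
qed (simp_all add: twisted_d_zero del: zero_fun_apply)

lemma twisted_d_scale:
  assumes "\<eta> \<in> forms_tensor A"
  shows "twisted_d A H w (\<lambda>c x vs. a *\<^sub>R \<eta> c x vs) = (\<lambda>c x vs. a *\<^sub>R twisted_d A H w \<eta> c x vs)"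
  using assms unfolding forms_tensor_eq
proof (induction rule: tensor_span_induct)
  case zero
  then show ?case using twisted_d_zero by (simp add: zero_fun_def)
next
  case (add \<omega> r \<xi>)
  have scaled: "(\<lambda>c x vs. a *\<^sub>R \<zeta> c x vs) \<in> forms_tensor A" if "\<zeta> \<in> forms_tensor A" for \<zeta> :: "('a, 'e, 'r) form"
    using that unfolding forms_tensor_eq
  proof (induction rule: tensor_span_induct)
    case zero
    then show ?case using tensor_span_zero by (simp add: zero_fun_def)
  next
    case (add \<omega> r \<xi>)
    have "(\<lambda>c x vs. a *\<^sub>R (tensor \<omega> r + \<xi>) c x vs) = tensor \<omega> (a *\<^sub>R r) + (\<lambda>c x vs. a *\<^sub>R \<xi> c x vs)"
      by (simp add: tensor_scale_right fun_eq_iff scaleR_add_right)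
    then show ?case using add by (auto intro!: tensor_span_add tensor_in_tensor_span)
  qed
  obtain p where p: "\<omega> \<in> forms A p" using add by blast
  have eq: "(\<lambda>c x vs. a *\<^sub>R (tensor \<omega> r + \<xi>) c x vs) = tensor \<omega> (a *\<^sub>R r) + (\<lambda>c x vs. a *\<^sub>R \<xi> c x vs)"
    by (simp add: tensor_scale_right fun_eq_iff scaleR_add_right)
  have in_span: "tensor \<omega> s \<in> forms_tensor A" for s
    using p by (auto simp: forms_tensor_eq intro!: tensor_in_tensor_span)
  have \<xi>: "\<xi> \<in> forms_tensor A" using add by (simp add: forms_tensor_eq)
  have "simple_d \<omega> (a *\<^sub>R r) = (\<lambda>c x vs. a *\<^sub>R simple_d \<omega> r c x vs)"
    by (simp add: simple_d_def tensor_scale_right fun_eq_iff sum_fun_apply scaleR_add_right scaleR_right.sum)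
  then show ?case
    unfolding eq twisted_d_add[OF in_span scaled[OF \<xi>]] twisted_d_add[OF in_span \<xi>] add.IH
    by (simp add: twisted_d_tensor[OF p] fun_eq_iff scaleR_add_right)
qed

lemma twisted_d_tensor_span:
  assumes P: "\<And>\<omega> r. P \<omega> r \<Longrightarrow> \<exists>p. \<omega> \<in> forms A p"
    and d: "\<And>\<omega> r. P \<omega> r \<Longrightarrow> Q (ext_d \<omega>) r"
    and W: "\<And>\<omega> r i. P \<omega> r \<Longrightarrow> 1 \<le> i \<Longrightarrow> Q (wedge (H i) \<omega>) (w i * r)"
    and \<eta>: "\<eta> \<in> tensor_span P"
  shows "twisted_d A H w \<eta> \<in> tensor_span Q"
  using \<eta>
proof (induction rule: tensor_span_induct)
  case zero
  then show ?case by (simp only: twisted_d_zero tensor_span_zero)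
next
  case (add \<omega> r \<xi>)
  obtain p where p: "\<omega> \<in> forms A p" using P add by blast
  have "tensor \<omega> r \<in> forms_tensor A" "\<xi> \<in> forms_tensor A"
    using p add(2) P unfolding forms_tensor_eq
    by (auto intro: tensor_in_tensor_span tensor_span_mono[of P])
  moreover have "simple_d \<omega> r \<in> tensor_span Q"
    unfolding simple_d_def using add(1)
    by (auto intro!: tensor_span_add tensor_span_sum tensor_in_tensor_span d W)
  ultimately show ?case
    using add.IH by (simp add: twisted_d_add twisted_d_tensor[OF p] tensor_span_add del: plus_fun_apply)
qed

lemma twisted_d_in_forms_tensor:
  "\<eta> \<in> forms_tensor A \<Longrightarrow> twisted_d A H w \<eta> \<in> forms_tensor A"
  unfolding forms_tensor_eq
  by (erule twisted_d_tensor_span[rotated -1]) (blast intro: ext_d_in_forms[OF X] wedge_in_forms[OF X H])+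

lemma twisted_d_twisted_d:
  assumes closed: "\<And>i. i \<ge> 1 \<Longrightarrow> ext_d (H i) = 0"
    and w_commute: "\<And>i j. i \<ge> 1 \<Longrightarrow> j \<ge> 1 \<Longrightarrow> w i * w j = w j * w i"
    and \<eta>: "\<eta> \<in> forms_tensor A"
  shows "twisted_d A H w (twisted_d A H w \<eta>) = 0"
  using \<eta> unfolding forms_tensor_eq
proof (induction rule: tensor_span_induct)
  case zero
  then show ?case by (simp only: twisted_d_zero)
next
  case (add \<omega> r \<xi>)
  obtain p where p: "\<omega> \<in> forms A p" using add by blast
  have in_span: "tensor \<omega>' s \<in> forms_tensor A" if "\<omega>' \<in> forms A k" for \<omega>' s k
    using that by (auto simp: forms_tensor_eq intro!: tensor_in_tensor_span)
  have \<xi>: "\<xi> \<in> forms_tensor A" using add by (simp add: forms_tensor_eq)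
  have dp: "ext_d \<omega> \<in> forms A (Suc p)" by (rule ext_d_in_forms[OF X p])
  have Wp: "wedge (H i) \<omega> \<in> forms A (2 * i + 1 + p)" if "i \<in> indices" for i
    using that by (intro wedge_in_forms[OF X H p]) simp
  have leibniz: "ext_d (wedge (H i) \<omega>) = - wedge (H i) (ext_d \<omega>)" if "i \<in> indices" for i
    using that by (intro ext_d_wedge_closed_odd[OF X H[of i] _ closed p]) simp_all
  \<comment> \<open>The term in which \<open>H i\<close> acts first and \<open>H j\<close>
    second.\<close>
  define a where "a = (\<lambda>i j. tensor (wedge (H j) (wedge (H i) \<omega>)) (w j * (w i * r)))"
  have "a i j c x vs = - a j i c x vs" if "i \<in> indices" "j \<in> indices" for i j c x vs
  proof -
    have "wedge (H j) (wedge (H i) \<omega>) = - wedge (H i) (wedge (H j) \<omega>)"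
      using that by (intro wedge_anticommute[OF X H[of j] _ H[of i]]) simp_all
    moreover have "w j * (w i * r) = w i * (w j * r)"
      using that w_commute[of i j] by (simp flip: mult.assoc)
    ultimately show ?thesis by (simp add: a_def tensor_minus_left)
  qed
  \<comment> \<open>Evaluated at \<open>c x vs\<close>, so that the summands lie in the real vector
    space of coefficients.\<close>
  then have anti: "(\<Sum>i\<in>indices. \<Sum>j\<in>indices. a i j c x vs) = 0" for c x vs
    by (rule sum_antisymmetric_eq_0)
  have W_sum: "(\<Sum>i\<in>indices. tensor (wedge (H i) \<omega>) (w i * r)) \<in> forms_tensor A"
    unfolding forms_tensor_eq by (rule tensor_span_sum) (rule in_span[OF Wp, unfolded forms_tensor_eq])
  have W_twisted: "twisted_d A H w (\<Sum>i\<in>indices. tensor (wedge (H i) \<omega>) (w i * r))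
      = (\<Sum>i\<in>indices. twisted_d A H w (tensor (wedge (H i) \<omega>) (w i * r)))"
    by (rule twisted_d_sum) (rule in_span[OF Wp])
  have "twisted_d A H w (simple_d \<omega> r)
      = twisted_d A H w (tensor (ext_d \<omega>) r)
        + (\<Sum>i\<in>indices. twisted_d A H w (tensor (wedge (H i) \<omega>) (w i * r)))"
    unfolding simple_d_def twisted_d_add[OF in_span[OF dp] W_sum] W_twisted by (rule refl)
  also have "\<dots> = simple_d (ext_d \<omega>) r + (\<Sum>i\<in>indices. simple_d (wedge (H i) \<omega>) (w i * r))"
    by (simp add: twisted_d_tensor[OF dp] twisted_d_tensor[OF Wp] del: plus_fun_apply)
  \<comment> \<open>Each mixed term in d and \<open>H i\<close> appears twice with the same
    coefficient \<open>w i * r\<close>, and \<open>leibniz\<close> gives the two copies opposite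
    signs.\<close>
  also have "\<dots> = (\<Sum>i\<in>indices. \<Sum>j\<in>indices. a i j)"
    by (simp add: simple_d_def ext_d_ext_d[OF X p] tensor_zero_left leibniz tensor_minus_left
        sum.distrib sum_negf sum_subtractf a_def del: plus_fun_apply zero_fun_apply)
  also have "\<dots> = 0"
    by (intro ext) (simp only: sum_fun_apply anti zero_fun_apply)
  finally have "twisted_d A H w (twisted_d A H w (tensor \<omega> r)) = 0"
    by (simp add: twisted_d_tensor[OF p])
  then show ?case
    using add.IH twisted_d_in_forms_tensor[OF \<xi>] twisted_d_in_forms_tensor[OF in_span[OF p]]
    by (simp add: twisted_d_add \<xi> in_span[OF p] del: plus_fun_apply zero_fun_apply)
qed

end

text \<open>The family \<open>v\<close> is arbitrary apart from degree and invertibility, which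
  covers dependent and independent coefficients. Each inverse has degree \<open>- 2 * i\<close>, so
  its product with a form of degree \<open>2 * i + 1\<close> has total degree 1.\<close>

theorem proposition5p2:
  fixes X :: "'a topology"
    and A :: "('a, 'e::real_inner) chart set"
    and G :: "int \<Rightarrow> 'r::real_algebra_1 set"
    and H :: "nat \<Rightarrow> ('a, 'e, real) form"
    and v w :: "nat \<Rightarrow> 'r"
  assumes manifold: "smooth_manifold X A"
    and coefficients: "graded_commutative G"
    and v_degree: "\<And>i. i \<ge> 1 \<Longrightarrow> v i \<in> G (2 * int i)"
    and v_inverse: "\<And>i. i \<ge> 1 \<Longrightarrow> v i * w i = 1 \<and> w i * v i = 1"
    and H_degree: "\<And>i. i \<ge> 1 \<Longrightarrow> H i \<in> forms A (2 * i + 1)"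
    and H_closed: "\<And>i. i \<ge> 1 \<Longrightarrow> ext_d (H i) = 0"
  shows "finite {i. 1 \<le> i \<and> H i \<noteq> 0}
    \<and> cochain_complex (forms_tensor_deg A G) (twisted_d A H w)
    \<and> (\<forall>\<eta>\<in>forms_tensor A. twisted_d A H w \<eta> \<in> forms_tensor A
                         \<and> twisted_d A H w (twisted_d A H w \<eta>) = 0)"
proof -
  have w: "w i \<in> G (- (2 * int i))" if "i \<ge> 1" for i
    using inverse_homogeneous[OF coefficients v_degree[OF that]] v_inverse[OF that] by blast
  have w_commute: "w i * w j = w j * w i" if "i \<ge> 1" "j \<ge> 1" for i j
  proof -
    have "w i * w j = (if odd (- (2 * int i)) \<and> odd (- (2 * int j)) then - (w j * w i) else w j * w i)"
      using coefficients w[OF that(1)] w[OF that(2)] unfolding graded_commutative_def by blast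
    \<comment> \<open>Both degrees are even, which excludes the branch with the minus sign.\<close>
    then show ?thesis by simp
  qed
  have mult: "a * b \<in> G (j + k)" if "a \<in> G j" "b \<in> G k" for a b j k
    using coefficients that unfolding graded_commutative_def by blast
  note square = twisted_d_twisted_d[OF manifold H_degree H_closed w_commute]
  have deg: "\<eta> \<in> forms_tensor A" if "\<eta> \<in> forms_tensor_deg A G m" for \<eta> m
    using that unfolding forms_tensor_eq forms_tensor_deg_eq by (rule tensor_span_mono[rotated]) blast
  have "twisted_d A H w \<eta> \<in> forms_tensor_deg A G (m + 1)" if "\<eta> \<in> forms_tensor_deg A G m" for \<eta> m
    using that unfolding forms_tensor_deg_eq
  proof (rule twisted_d_tensor_span[OF manifold H_degree, rotated -1])
    fix \<omega> :: "('a, 'e, real) form" and r :: 'r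
    assume "\<exists>p q. \<omega> \<in> forms A p \<and> r \<in> G q \<and> int p + q = m"
    then obtain p q where pq: "\<omega> \<in> forms A p" "r \<in> G q" "int p + q = m" by blast
    then show "\<exists>p. \<omega> \<in> forms A p" by blast
    show "\<exists>p q. ext_d \<omega> \<in> forms A p \<and> r \<in> G q \<and> int p + q = m + 1"
      using ext_d_in_forms[OF manifold pq(1)] pq by (intro exI[of _ "Suc p"] exI[of _ q]) simp
    show "\<exists>p q. wedge (H i) \<omega> \<in> forms A p \<and> w i * r \<in> G q \<and> int p + q = m + 1" if "1 \<le> i" for i
      using wedge_in_forms[OF manifold H_degree[OF that] pq(1)] mult[OF w[OF that] pq(2)] pq(3)
      \<comment> \<open>The form degree rises by \<open>2 * i + 1\<close> and the coefficient degree
        falls by \<open>2 * i\<close>, a net gain of 1.\<close>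
      by (intro exI[of _ "2 * i + 1 + p"] exI[of _ "- (2 * int i) + q"]) simp
  qed
  then have "cochain_complex (forms_tensor_deg A G) (twisted_d A H w)"
    unfolding cochain_complex_def
    by (intro allI conjI ballI square twisted_d_add[OF manifold H_degree] twisted_d_scale[OF manifold H_degree])
      (simp_all add: deg)
  then show ?thesis
    by (intro conjI ballI finite_nonzero_forms[OF manifold H_degree] square
        twisted_d_in_forms_tensor[OF manifold H_degree])
qed

end
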